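(* Let $a\in\mathbb{Q}$ and let $f(x)=x^8+ax^4+1\in\mathbb{Q}[x]$ be irreducible over $\mathbb{Q}$. Then $\mathrm{Gal}(f)$ is (1) 8T3 if $a+2\in\mathbb{Q}^2$; (2) 8T4 if $a+2\notin\mathbb{Q}^2$ and $a-2\in\mathbb{Q}^2$; (3) 8T2 if $a+2\notin\mathbb{Q}^2$, $a-2\notin\mathbb{Q}^2$ and $4-a^2\in\mathbb{Q}^2$; (4) 8T9 if $a+2\notin\mathbb{Q}^2$, $a-2\notin\mathbb{Q}^2$ and $4-a^2\notin\mathbb{Q}^2$.
   Context: $\mathbb{Q}^2=\{k^2:k\in\mathbb{Q}\}$. $\mathrm{Gal}(f)$ is the Galois group over $\mathbb{Q}$ of (the splitting field of) $f$, viewed as a transitive permutation group on the eight roots of $f$, i.e. as a transitive subgroup of $S_8$ up to conjugacy. 8Tj denotes the $j$-th conjugacy class of transitive subgroups of $S_8$ in the Butler–McKay (LMFDB) numbering. The classes used here are identified as follows; each consists of exactly the transitive subgroups of $S_8$ that are isomorphic, as abstract groups, to the indicated group: 8T2: $C_4\times C_2$ (order 8); 8T3: $C_2^3$ (order 8); 8T4: the dihedral group $D_4$ of order 8; 8T9: $C_2\times D_4$ (order 16). *)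

theory Defs
  imports
    "HOL-Algebra.Algebraic_Closure_Type"
    "HOL-Algebra.Generated_Fields"
    "HOL-Algebra.QuotRing"
    "HOL-Algebra.Elementary_Groups"
    "HOL-Algebra.Sym_Groups"
    Complex_Main
begin

text \<open>HOL-Algebra also has constants called \<open>monom\<close> and \<open>irreducible\<close>; the qualified
  names refer to the type-class polynomials of HOL-Computational-Algebra.\<close>

definition octic :: "rat \<Rightarrow> rat poly" where
  "octic a = Polynomial.monom 1 8 + Polynomial.monom a 4 + 1"

definition rat_squares :: "rat set" where
  "rat_squares = {k\<^sup>2 | k. True}"

definition complex_roots :: "rat poly \<Rightarrow> complex set" where
  "complex_roots f = {z. poly (map_poly of_rat f) z = 0}"

definition complex_field :: "complex ring" where
  "complex_field = ring_of_type_algebra"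

definition splitting_field :: "rat poly \<Rightarrow> complex set" where
  "splitting_field f = generate_field complex_field (\<rat> \<union> complex_roots f)"

text \<open>As usual for HOL-Algebra homomorphisms, the values of \<open>\<sigma>\<close> outside the splitting field are
  left unconstrained, so an automorphism is represented by many functions; they all
  induce the same permutation of the roots.\<close>

definition galois_automorphisms :: "rat poly \<Rightarrow> (complex \<Rightarrow> complex) set" where
  "galois_automorphisms f =
     {\<sigma> \<in> ring_iso (complex_field\<lparr>carrier := splitting_field f\<rparr>)
                    (complex_field\<lparr>carrier := splitting_field f\<rparr>). \<forall>q\<in>\<rat>. \<sigma> q = q}"

text \<open>The permutation group that \<open>Gal(f)\<close> induces on \<open>{1..n}\<close> via a labelling
  \<open>r 1, \<dots>, r n\<close> of the roots. Changing the labelling replaces it by a conjugate in \<open>S\<^sub>n\<close>.\<close>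

definition galois_perm_group :: "rat poly \<Rightarrow> (nat \<Rightarrow> complex) \<Rightarrow> (nat \<Rightarrow> nat) set" where
  "galois_perm_group f r =
     {p \<in> carrier (sym_group (degree f)).
        \<exists>\<sigma>\<in>galois_automorphisms f. \<forall>i\<in>{1..degree f}. \<sigma> (r i) = r (p i)}"

definition root_labelling :: "rat poly \<Rightarrow> (nat \<Rightarrow> complex) \<Rightarrow> bool" where
  "root_labelling f r \<longleftrightarrow> bij_betw r {1..degree f} (complex_roots f)"

text \<open>For a class \<open>T\<close> of permutation groups closed under conjugacy this says that \<open>Gal(f)\<close>,
  as a permutation group up to conjugacy, belongs to \<open>T\<close>. The existential conjunct excludes
  vacuity for polynomials with multiple roots.\<close>

definition galois_group_is :: "rat poly \<Rightarrow> (nat \<Rightarrow> nat) set set \<Rightarrow> bool" where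
  "galois_group_is f T \<longleftrightarrow>
     (\<exists>r. root_labelling f r) \<and> (\<forall>r. root_labelling f r \<longrightarrow> galois_perm_group f r \<in> T)"

definition transitive_perm_groups :: "nat \<Rightarrow> (nat \<Rightarrow> nat) set set" where
  "transitive_perm_groups n =
     {H. subgroup H (sym_group n) \<and> (\<forall>i\<in>{1..n}. \<forall>j\<in>{1..n}. \<exists>p\<in>H. p i = j)}"

definition transitive_perm_groups_iso :: "nat \<Rightarrow> 'a monoid \<Rightarrow> (nat \<Rightarrow> nat) set set" where
  "transitive_perm_groups_iso n G =
     {H \<in> transitive_perm_groups n. (sym_group n)\<lparr>carrier := H\<rparr> \<cong> G}"

text \<open>The dihedral group of order \<open>2 * n\<close> (for \<open>n > 0\<close>): the pair \<open>(i, s)\<close> stands for the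
  product \<open>\<rho>^i * \<tau>^s\<close> of a rotation and a reflection, where \<open>\<tau> * \<rho> = \<rho>^(-1) * \<tau>\<close>.\<close>

definition dihedral_group :: "nat \<Rightarrow> (int \<times> bool) monoid" where
  "dihedral_group n =
     \<lparr>carrier = {0..<int n} \<times> UNIV,
      monoid.mult = (\<lambda>(i, s) (j, t). ((if s then i - j else i + j) mod int n, s \<noteq> t)),
      one = (0, False)\<rparr>"

lemma dihedral_group_group:
  assumes "n > 0"
  shows "group (dihedral_group n)"
proof (rule groupI)
  fix x assume "x \<in> carrier (dihedral_group n)"
  then show "\<exists>y\<in>carrier (dihedral_group n). y \<otimes>\<^bsub>dihedral_group n\<^esub> x = \<one>\<^bsub>dihedral_group n\<^esub>"
    using assms
    by (intro bexI[of _ "(if snd x then fst x else (- fst x) mod int n, snd x)"])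
       (auto simp: dihedral_group_def mod_simps)
qed (use assms in \<open>auto simp: dihedral_group_def mod_simps algebra_simps\<close>)

lemma order_dihedral_group: "Coset.order (dihedral_group n) = 2 * n"
  by (simp add: Coset.order_def dihedral_group_def card_cartesian_product)

text \<open>Each of the following is a single conjugacy class of subgroups of \<open>S\<^sub>8\<close>, numbered as by
  Butler and McKay.\<close>

definition T8_2 :: "(nat \<Rightarrow> nat) set set" where
  "T8_2 = transitive_perm_groups_iso 8 (integer_mod_group 4 \<times>\<times> integer_mod_group 2)"

definition T8_3 :: "(nat \<Rightarrow> nat) set set" where
  "T8_3 = transitive_perm_groups_iso 8
            (integer_mod_group 2 \<times>\<times> integer_mod_group 2 \<times>\<times> integer_mod_group 2)"

definition T8_4 :: "(nat \<Rightarrow> nat) set set" where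
  "T8_4 = transitive_perm_groups_iso 8 (dihedral_group 4)"

definition T8_9 :: "(nat \<Rightarrow> nat) set set" where
  "T8_9 = transitive_perm_groups_iso 8 (integer_mod_group 2 \<times>\<times> dihedral_group 4)"

end

theory Submission
  imports Defs
begin

text \<open>
  Let \<open>\<alpha>\<close> be a complex root of \<open>f = x\<^sup>8 + a x\<^sup>4 + 1\<close>. Since \<open>f\<close> is a polynomial in \<open>x\<^sup>4\<close> and is
  reciprocal, the numbers \<open>(\<i>\<^sup>m \<alpha>)\<^sup>\<plusminus>\<^sup>1\<close> are roots as well; by irreducibility \<open>\<alpha>\<^sup>8 \<noteq> 1\<close>, so these are eight
  different numbers, hence all the roots, and the splitting field is \<open>\<rat>(\<alpha>, \<i>)\<close>. An automorphism is
  determined by the image \<open>(\<i>\<^sup>k \<alpha>)\<^sup>\<plusminus>\<^sup>1\<close> of \<open>\<alpha>\<close> and the image \<open>\<plusminus> \<i>\<close> of \<open>\<i>\<close>. The sixteen conceivable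
  pairs of images form the group \<open>C\<^sub>2 \<times> D\<^sub>4\<close>, and they act on the root \<open>(\<i>\<^sup>m \<alpha>)\<^sup>\<plusminus>\<^sup>1\<close> factor by factor:
  \<open>C\<^sub>2\<close> acts on the exponent \<open>\<plusminus>1\<close> and \<open>D\<^sub>4\<close> acts on \<open>m\<close> modulo 4 as on the corners of a square. So the
  Galois group is a subgroup \<open>S\<close> of \<open>C\<^sub>2 \<times> D\<^sub>4\<close>.

  Irreducibility makes \<open>S\<close> transitive on the roots (\<open>galois_transitive\<close>), so its order is 8 or 16. The
  transitive subgroups are \<open>C\<^sub>2 \<times> D\<^sub>4\<close> itself and the kernels of the four sign characters that are
  nontrivial on the reflection fixing \<open>\<alpha>\<close> (\<open>index_two_subgroup_cases\<close>). By these characters \<open>C\<^sub>2 \<times> D\<^sub>4\<close>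
  acts on \<open>\<i> D\<close>, where \<open>D\<close> is one of
  \<open>1\<close>, \<open>\<alpha>\<^sup>2 + \<alpha>\<^sup>-\<^sup>2\<close>, \<open>\<alpha>\<^sup>2 - \<alpha>\<^sup>-\<^sup>2\<close> and \<open>\<alpha>\<^sup>4 - \<alpha>\<^sup>-\<^sup>4\<close>.
  The squares of these four elements \<open>\<i> D\<close> are the rational numbers \<open>-1\<close>, \<open>a - 2\<close>, \<open>a + 2\<close> and
  \<open>4 - a\<^sup>2\<close>. As the fixed field of \<open>S\<close> is \<open>\<rat>\<close> (\<open>fixed_imp_rational\<close>), \<open>S\<close> lies in the kernel of a
  character if and only if the corresponding number is a square in \<open>\<rat>\<close>
  (\<open>rat_square_iff_galois_triples_subset\<close>). This never happens for \<open>-1\<close>; for \<open>a - 2\<close>, \<open>a + 2\<close> and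
  \<open>4 - a\<^sup>2\<close> the kernels are isomorphic to \<open>D\<^sub>4\<close>, \<open>C\<^sub>2\<^sup>3\<close> and \<open>C\<^sub>4 \<times> C\<^sub>2\<close>; and if none of the three is a
  square, then \<open>S\<close> is all of \<open>C\<^sub>2 \<times> D\<^sub>4\<close>.
\<close>

section \<open>Rational polynomials at complex arguments\<close>

definition eval_rat :: "rat poly \<Rightarrow> complex \<Rightarrow> complex" where
  "eval_rat p z = poly (map_poly of_rat p) z"

lemma eval_rat_pCons [simp]: "eval_rat (pCons c p) z = of_rat c + z * eval_rat p z"
  by (simp add: eval_rat_def map_poly_pCons)

lemma eval_rat_0 [simp]: "eval_rat 0 z = 0"
  by (simp add: eval_rat_def)

lemma eval_rat_1 [simp]: "eval_rat 1 z = 1"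
  by (simp add: one_pCons)

lemma eval_rat_add [simp]: "eval_rat (p + q) z = eval_rat p z + eval_rat q z"
  by (induction p q rule: poly_induct2) (simp_all add: of_rat_add algebra_simps)

lemma eval_rat_smult [simp]: "eval_rat (Polynomial.smult c p) z = of_rat c * eval_rat p z"
  by (induction p) (simp_all add: of_rat_mult algebra_simps)

lemma eval_rat_minus [simp]: "eval_rat (- p) z = - eval_rat p z"
  by (induction p) (simp_all add: of_rat_minus algebra_simps)

lemma eval_rat_diff [simp]: "eval_rat (p - q) z = eval_rat p z - eval_rat q z"
  using eval_rat_add[of p "- q"] by simp

lemma eval_rat_mult [simp]: "eval_rat (p * q) z = eval_rat p z * eval_rat q z"
  by (induction p) (simp_all add: algebra_simps)

lemma eval_rat_power [simp]: "eval_rat (p ^ n) z = eval_rat p z ^ n"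
  by (induction n) simp_all

lemma eval_rat_monom [simp]: "eval_rat (Polynomial.monom c n) z = of_rat c * z ^ n"
  by (simp add: eval_rat_def map_poly_monom poly_monom)

lemma eval_rat_octic [simp]: "eval_rat (octic a) z = z ^ 8 + of_rat a * z ^ 4 + 1"
  by (simp add: octic_def)

lemma complex_roots_eval_rat: "complex_roots f = {z. eval_rat f z = 0}"
  by (simp add: complex_roots_def eval_rat_def)

lemma degree_octic [simp]: "Polynomial.degree (octic a) = 8"
proof -
  have "octic a = [:1, 0, 0, 0, a, 0, 0, 0, 1:]"
    by (simp add: octic_def monom_altdef numeral_eq_Suc one_pCons)
  then show ?thesis by simp
qed

text \<open>Bezout: modulo the irreducible \<open>f\<close> every polynomial that \<open>f\<close> does not divide is invertible, and
  evaluation at a root of \<open>f\<close> factors through the residue ring. Hence \<open>\<rat>[z]\<close> is a field.\<close>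
lemma irreducible_eval_unit:
  assumes "Factorial_Ring.irreducible f" "eval_rat f z = 0" "\<not> f dvd p"
  shows "\<exists>v. eval_rat v z * eval_rat p z = 1"
proof -
  have "coprime f p"
    using assms by (metis field_poly_irreducible_imp_prime prime_elem_imp_coprime)
  then obtain u v where "u * f + v * p = 1"
    by (metis bezout_coefficients_fst_snd coprime_iff_gcd_eq_1)
  then have "eval_rat (u * f + v * p) z = 1" by simp
  with assms(2) show ?thesis by auto
qed

lemma irreducible_dvd_of_common_root:
  assumes "Factorial_Ring.irreducible f" "eval_rat f z = 0" "eval_rat p z = 0"
  shows "f dvd p"
  using irreducible_eval_unit[OF assms(1,2)] assms(3) by force

lemma irreducible_conjugate_root:
  assumes "Factorial_Ring.irreducible f" "eval_rat f z = 0" "eval_rat p z = 0" "eval_rat f w = 0"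
  shows "eval_rat p w = 0"
  using irreducible_dvd_of_common_root[OF assms(1-3)] assms(4) by (auto elim!: dvdE)

lemma irreducible_degree_le:
  assumes "Factorial_Ring.irreducible f" "eval_rat f z = 0" "eval_rat p z = 0" "p \<noteq> 0"
  shows "Polynomial.degree f \<le> Polynomial.degree p"
  using irreducible_dvd_of_common_root[OF assms(1-3)] assms(4) by (rule dvd_imp_degree_le)

text \<open>The remainder of \<open>g\<close> modulo \<open>f\<close> takes the value \<open>y\<close> more often than its degree allows unless it is
  the constant \<open>y\<close>, and its coefficients are rational.\<close>
lemma constant_on_roots_imp_rational:
  assumes card: "card (complex_roots f) \<ge> Polynomial.degree f" and deg: "Polynomial.degree f > 0"
    and const: "\<And>z. z \<in> complex_roots f \<Longrightarrow> eval_rat g z = y"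
  shows "y \<in> \<rat>"
proof -
  define r where "r = g mod f"
  have f0: "f \<noteq> 0" using deg by auto
  have r: "eval_rat r z = y" if "z \<in> complex_roots f" for z
  proof -
    have "g = (g div f) * f + r" by (simp add: r_def)
    then have "eval_rat g z = eval_rat ((g div f) * f + r) z" by simp
    also have "\<dots> = eval_rat r z" using that by (simp add: complex_roots_eval_rat)
    finally show ?thesis using const[OF that] by simp
  qed
  have dr: "Polynomial.degree r < Polynomial.degree f"
    using degree_mod_less'[of f g] f0 deg by (cases "r = 0") (auto simp: r_def)
  define R where "R = map_poly of_rat r - [:y:]"
  have dR: "Polynomial.degree R < Polynomial.degree f"
  proof -
    have "Polynomial.degree R \<le> Polynomial.degree r"
      unfolding R_def using map_poly_degree_leq[of of_rat r] by (intro degree_diff_le) auto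
    then show ?thesis using dr by simp
  qed
  have "R = 0"
  proof (rule ccontr)
    assume R0: "R \<noteq> 0"
    have "complex_roots f \<subseteq> {z. poly R z = 0}" using r by (auto simp: R_def eval_rat_def)
    then have "card (complex_roots f) \<le> card {z. poly R z = 0}"
      using R0 poly_roots_finite by (intro card_mono) auto
    also have "\<dots> \<le> Polynomial.degree R" by (rule card_poly_roots_bound[OF R0])
    finally show False using dR card by simp
  qed
  then have "poly.coeff (map_poly of_rat r) 0 = y" by (simp add: R_def)
  then show ?thesis by (auto simp: coeff_map_poly)
qed

lemma complex_root_exists: "Polynomial.degree f > 0 \<Longrightarrow> complex_roots f \<noteq> {}"
proof -
  assume "Polynomial.degree f > 0"
  then have "Polynomial.degree (map_poly of_rat f :: complex poly) > 0" by (simp add: degree_map_poly)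
  then show ?thesis using alg_closed_imp_poly_has_root by (force simp: complex_roots_def)
qed

section \<open>Permutation groups given by faithful actions\<close>

text \<open>An action of \<open>G\<close> on an \<open>n\<close>-element set becomes a homomorphism into the symmetric group after the
  points have been numbered by \<open>b\<close>. The lemma reads off the class of a permutation group that is only
  known as the set of permutations induced by elements of \<open>S\<close>. For transitivity it suffices to reach
  every point from the base point \<open>x0\<close>.\<close>
lemma perm_group_of_faithful_action:
  fixes G :: "'g monoid" and act :: "'g \<Rightarrow> 'x \<Rightarrow> 'x" and b :: "nat \<Rightarrow> 'x"
  assumes G: "group G" and S: "subgroup S G"
    and closed: "\<And>g x. g \<in> carrier G \<Longrightarrow> x \<in> \<Omega> \<Longrightarrow> act g x \<in> \<Omega>"
    and act_one: "\<And>x. x \<in> \<Omega> \<Longrightarrow> act \<one>\<^bsub>G\<^esub> x = x"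
    and act_mult: "\<And>g h x. g \<in> carrier G \<Longrightarrow> h \<in> carrier G \<Longrightarrow> x \<in> \<Omega> \<Longrightarrow>
        act (g \<otimes>\<^bsub>G\<^esub> h) x = act g (act h x)"
    and faithful: "\<And>g h. g \<in> carrier G \<Longrightarrow> h \<in> carrier G \<Longrightarrow>
        (\<And>x. x \<in> \<Omega> \<Longrightarrow> act g x = act h x) \<Longrightarrow> g = h"
    and b: "bij_betw b {1..n} \<Omega>"
    and x0: "x0 \<in> \<Omega>" and trans: "\<And>x. x \<in> \<Omega> \<Longrightarrow> \<exists>g\<in>S. act g x0 = x"
    and P: "P = {p \<in> carrier (sym_group n). \<exists>g\<in>S. \<forall>i\<in>{1..n}. b (p i) = act g (b i)}"
  shows "P \<in> transitive_perm_groups_iso n (G\<lparr>carrier := S\<rparr>)"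
proof -
  interpret G: group G by fact
  interpret S: subgroup S G by fact
  interpret Sy: group "sym_group n" by (rule sym_group_is_group)
  define I where "I = {1..n}"
  have bI: "bij_betw b I \<Omega>" using b by (simp add: I_def)
  have perm_iff: "p \<in> carrier (sym_group n) \<longleftrightarrow> p permutes I" for p
    by (simp add: sym_group_carrier I_def)
  have P: "P = {p \<in> carrier (sym_group n). \<exists>g\<in>S. \<forall>i\<in>I. b (p i) = act g (b i)}"
    by (simp add: P I_def)
  have b_mem: "b i \<in> \<Omega>" if "i \<in> I" for i
    using bij_betwE[OF bI] that by blast
  have binj: "i = j" if "b i = b j" "i \<in> I" "j \<in> I" for i j
    using inj_onD[OF bij_betw_imp_inj_on[OF bI] that] .
  have act_inv: "act (inv\<^bsub>G\<^esub> g) (act g x) = x" "act g (act (inv\<^bsub>G\<^esub> g) x) = x"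
    if "g \<in> carrier G" "x \<in> \<Omega>" for g x
    using act_mult[of "inv\<^bsub>G\<^esub> g" g x] act_mult[of g "inv\<^bsub>G\<^esub> g" x] act_one that by simp_all
  define b' where "b' = the_inv_into I b"
  have b'_mem: "b' x \<in> I" if "x \<in> \<Omega>" for x
    using bI that unfolding b'_def bij_betw_def by (metis the_inv_into_into subset_refl)
  have bb': "b (b' x) = x" if "x \<in> \<Omega>" for x
    using bI that unfolding b'_def bij_betw_def by (metis f_the_inv_into_f)
  have b'b: "b' (b i) = i" if "i \<in> I" for i
    using bI that unfolding b'_def bij_betw_def by (metis the_inv_into_f_f)
  define \<Phi> where "\<Phi> g i = (if i \<in> I then b' (act g (b i)) else i)" for g i
  have \<Phi>_mem: "\<Phi> g i \<in> I" if "g \<in> carrier G" "i \<in> I" for g i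
    using that by (simp add: \<Phi>_def b'_mem closed b_mem)
  have b\<Phi>: "b (\<Phi> g i) = act g (b i)" if "g \<in> carrier G" "i \<in> I" for g i
    using that by (simp add: \<Phi>_def bb' closed b_mem)
  have \<Phi>_mult: "\<Phi> (g \<otimes>\<^bsub>G\<^esub> h) = \<Phi> g \<circ> \<Phi> h" if "g \<in> carrier G" "h \<in> carrier G" for g h
  proof
    fix i show "\<Phi> (g \<otimes>\<^bsub>G\<^esub> h) i = (\<Phi> g \<circ> \<Phi> h) i"
    proof (cases "i \<in> I")
      case True
      show ?thesis
        by (rule binj) (use that True in \<open>simp_all only: o_def b\<Phi> \<Phi>_mem act_mult b_mem G.m_closed\<close>)
    qed (simp only: \<Phi>_def if_False o_def)
  qed
  have \<Phi>_one: "\<Phi> \<one>\<^bsub>G\<^esub> = id"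
    by (auto simp: \<Phi>_def fun_eq_iff act_one b_mem b'b)
  have \<Phi>_permutes: "\<Phi> g permutes I" if g: "g \<in> carrier G" for g
  proof (rule bij_imp_permutes)
    have "\<Phi> (inv\<^bsub>G\<^esub> g) \<circ> \<Phi> g = id" "\<Phi> g \<circ> \<Phi> (inv\<^bsub>G\<^esub> g) = id"
      using \<Phi>_mult[of "inv\<^bsub>G\<^esub> g" g] \<Phi>_mult[of g "inv\<^bsub>G\<^esub> g"] g \<Phi>_one by simp_all
    then show "bij_betw (\<Phi> g) I I"
      using \<Phi>_mem g by (intro bij_betw_byWitness[where f' = "\<Phi> (inv\<^bsub>G\<^esub> g)"])
        (auto simp: fun_eq_iff)
    show "\<Phi> g i = i" if "i \<notin> I" for i using that by (simp only: \<Phi>_def if_False)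
  qed
  have \<Phi>_eqI: "p = \<Phi> g" if "p permutes I" "g \<in> carrier G"
    "\<forall>i\<in>I. b (p i) = act g (b i)" for p g
  proof
    fix i show "p i = \<Phi> g i"
    proof (cases "i \<in> I")
      case True
      show ?thesis
        by (rule binj) (use that True in \<open>simp_all only: b\<Phi> \<Phi>_mem permutes_in_image[OF that(1)]\<close>)
    next
      case False
      then show ?thesis by (simp add: \<Phi>_def permutes_not_in[OF that(1)])
    qed
  qed
  have P_eq: "P = \<Phi> ` S"
  proof (intro equalityI subsetI)
    fix p assume "p \<in> P"
    then obtain g where "p permutes I" "g \<in> S" "\<forall>i\<in>I. b (p i) = act g (b i)"
      by (auto simp: P perm_iff)
    then show "p \<in> \<Phi> ` S" using \<Phi>_eqI[of p g] by auto
  qed (auto simp: P perm_iff \<Phi>_permutes b\<Phi>)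
  have inj: "inj_on \<Phi> S"
  proof
    fix g h assume gh: "g \<in> S" "h \<in> S" "\<Phi> g = \<Phi> h"
    show "g = h"
    proof (rule faithful)
      fix x assume "x \<in> \<Omega>"
      with gh show "act g x = act h x"
        using b\<Phi>[of g "b' x"] b\<Phi>[of h "b' x"] by (simp add: b'_mem bb')
    qed (use gh in auto)
  qed
  have hom: "\<Phi> \<in> hom (G\<lparr>carrier := S\<rparr>) (sym_group n)"
    by (auto simp: hom_def sym_group_mult perm_iff \<Phi>_permutes \<Phi>_mult)
  have sub: "subgroup P (sym_group n)"
  proof -
    interpret h: group_hom "G\<lparr>carrier := S\<rparr>" "sym_group n" \<Phi>
      by (intro group_hom.intro group_hom_axioms.intro hom G.subgroup_imp_group[OF S] sym_group_is_group)
    show ?thesis using h.img_is_subgroup by (simp add: P_eq)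
  qed
  have "\<exists>p\<in>P. p i = j" if "i \<in> I" "j \<in> I" for i j
  proof -
    obtain g h where g: "g \<in> S" "act g x0 = b i" and h: "h \<in> S" "act h x0 = b j"
      using trans b_mem \<open>i \<in> I\<close> \<open>j \<in> I\<close> by metis
    have "b (\<Phi> (h \<otimes>\<^bsub>G\<^esub> inv\<^bsub>G\<^esub> g) i) = act (h \<otimes>\<^bsub>G\<^esub> inv\<^bsub>G\<^esub> g) (b i)"
      using g h that by (intro b\<Phi>) auto
    also have "\<dots> = act h (act (inv\<^bsub>G\<^esub> g) (act g x0))"
      using g h that b_mem by (subst act_mult) auto
    also have "\<dots> = b j" using g h by (subst act_inv(1)[OF _ x0]) auto
    finally have "\<Phi> (h \<otimes>\<^bsub>G\<^esub> inv\<^bsub>G\<^esub> g) i = j"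
      by (rule binj) (use that g h in \<open>auto intro!: \<Phi>_mem\<close>)
    then show ?thesis using g h by (auto simp: P_eq)
  qed
  moreover have "(sym_group n)\<lparr>carrier := P\<rparr> \<cong> G\<lparr>carrier := S\<rparr>"
  proof (rule group.iso_sym[OF G.subgroup_imp_group[OF S]])
    have "\<Phi> \<in> iso (G\<lparr>carrier := S\<rparr>) ((sym_group n)\<lparr>carrier := P\<rparr>)"
      using hom inj by (intro isoI) (auto simp: hom_def P_eq bij_betw_def)
    then show "G\<lparr>carrier := S\<rparr> \<cong> (sym_group n)\<lparr>carrier := P\<rparr>" by (auto simp: is_iso_def)
  qed
  ultimately show ?thesis
    using sub by (auto simp: I_def transitive_perm_groups_iso_def transitive_perm_groups_def)
qed

lemma transitive_perm_groups_iso_cong: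
  assumes "H \<in> transitive_perm_groups_iso n G" "G \<cong> G'"
  shows "H \<in> transitive_perm_groups_iso n G'"
  using assms iso_trans by (auto simp: transitive_perm_groups_iso_def)

section \<open>Subgroups of the direct product of a group of order two and a dihedral group\<close>

text \<open>In a triple \<open>(c, k, s)\<close> the entry \<open>c\<close> says whether the roots are inverted, and \<open>(k, s)\<close> is the rotation
  by \<open>k\<close> after a reflection, if \<open>s\<close>, of the exponents of \<open>\<i>\<close> modulo 4.\<close>
abbreviation C2_D4 :: "(int \<times> int \<times> bool) monoid" where
  "C2_D4 \<equiv> integer_mod_group 2 \<times>\<times> dihedral_group 4"

lemma group_C2_D4: "group C2_D4"
  by (intro DirProd_group group_integer_mod_group dihedral_group_group) simp

lemma carrier_C2_D4: "(c, k, s) \<in> carrier C2_D4 \<longleftrightarrow> c \<in> {0, 1} \<and> k \<in> {0, 1, 2, 3}"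
  by (auto simp: carrier_integer_mod_group dihedral_group_def)

lemma one_C2_D4: "\<one>\<^bsub>C2_D4\<^esub> = (0, 0, False)"
  by (simp add: dihedral_group_def)

lemma mult_C2_D4: "(c, k, s) \<otimes>\<^bsub>C2_D4\<^esub> (c', k', s') =
    ((c + c') mod 2, (if s then k - k' else k + k') mod 4, s \<noteq> s')"
  by (simp add: dihedral_group_def)

lemma carrier_C2: "carrier (integer_mod_group 2) = {0, 1}"
  by (auto simp: carrier_integer_mod_group)

lemma carrier_D4: "carrier (dihedral_group 4) = {0, 1, 2, 3} \<times> UNIV"
  by (auto simp: dihedral_group_def)

lemma mult_D4: "(k, s) \<otimes>\<^bsub>dihedral_group 4\<^esub> (k', s') = ((if s then k - k' else k + k') mod 4, s \<noteq> s')"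
  by (simp add: dihedral_group_def)

lemma finite_C2_D4: "finite (carrier C2_D4)"
  by (simp add: carrier_integer_mod_group dihedral_group_def)

text \<open>The kernel of the sign character that is \<open>-1\<close> on the reflection \<open>(0, 0, True)\<close>, and on the generators
  \<open>(0, 1, False)\<close> and \<open>(1, 0, False)\<close> is \<open>-1\<close> exactly if \<open>u\<close> and \<open>v\<close> hold, respectively.\<close>
definition index_two_subgroup :: "bool \<Rightarrow> bool \<Rightarrow> (int \<times> int \<times> bool) set" where
  "index_two_subgroup u v = {(c, k, s) \<in> carrier C2_D4. s \<longleftrightarrow> (u \<and> odd k) \<noteq> (v \<and> odd c)}"

lemma (in group) finite_closed_imp_subgroup:
  assumes fin: "finite (carrier G)" and sub: "H \<subseteq> carrier G" and ne: "H \<noteq> {}"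
    and closed: "\<And>x y. x \<in> H \<Longrightarrow> y \<in> H \<Longrightarrow> x \<otimes> y \<in> H"
  shows "subgroup H G"
proof (rule subgroupI)
  fix x assume x: "x \<in> H"
  then have xG: "x \<in> carrier G" using sub by auto
  \<comment> \<open>The inverse of \<open>x\<close> is a power of \<open>x\<close> with positive exponent. The exponent \<open>2 n - 1\<close> for the order \<open>n\<close> is
    positive even if \<open>n = 1\<close>.\<close>
  have pow: "x [^] (Suc n) \<in> H" for n
    by (induction n) (use x xG in \<open>auto intro: closed\<close>)
  define n where "n = ord x"
  have n: "n > 0" unfolding n_def using ord_ge_1[OF fin xG] by simp
  have "x [^] (2 * n - 1) \<in> H" using pow[of "2 * n - 2"] n by (simp add: Suc_diff_Suc numeral_2_eq_2)
  moreover have "x [^] (2 * n - 1) \<otimes> x = \<one>"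
  proof -
    have "x [^] (2 * n - 1) \<otimes> x = x [^] (2 * n)" using n by (cases n) (auto simp: xG)
    also have "\<dots> = \<one>" using pow_ord_eq_1[OF xG] xG
      by (metis mult.commute n_def nat_pow_one nat_pow_pow)
    finally show ?thesis .
  qed
  ultimately show "inv x \<in> H" using inv_equality xG sub by (metis subsetD)
qed (use assms in auto)

text \<open>Transitivity on the roots means that \<open>S\<close> projects onto all pairs \<open>(c, k)\<close>. The fibres of this projection
  are the left cosets of the subgroup generated by the reflection \<open>(0, 0, True)\<close>. If \<open>S\<close> contains this
  reflection, it is the whole group.
  Otherwise it meets every fibre once, and it is determined by its elements over the generators
  \<open>(0, 1)\<close> and \<open>(1, 0)\<close>.\<close>
lemma index_two_subgroup_cases:
  assumes S: "subgroup S C2_D4"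
    and proj: "\<And>c k. c \<in> {0, 1} \<Longrightarrow> k \<in> {0, 1, 2, 3} \<Longrightarrow> \<exists>s. (c, k, s) \<in> S"
  shows "S = carrier C2_D4 \<or> (\<exists>u v. S = index_two_subgroup u v)"
proof (cases "S = carrier C2_D4")
  case False
  interpret G: group C2_D4 by (rule group_C2_D4)
  interpret S: subgroup S C2_D4 by fact
  have mult: "((c + c') mod 2, (if s then k - k' else k + k') mod 4, s \<noteq> s') \<in> S"
    if "(c, k, s) \<in> S" "(c', k', s') \<in> S" for c k s c' k' s'
    using S.m_closed[OF that] by (simp only: mult_C2_D4)
  have refl: "(0, 0, True) \<notin> S"
  proof
    assume *: "(0, 0, True) \<in> S"
    have "(c, k, s) \<in> S" if "(c, k, s) \<in> carrier C2_D4" for c k s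
    proof -
      from that obtain s' where s': "(c, k, s') \<in> S" using proj carrier_C2_D4 by blast
      with mult[OF s' *] that show ?thesis
        unfolding carrier_C2_D4 by (cases s; cases s') (auto simp: mult.commute)
    qed
    then have "carrier C2_D4 \<subseteq> S" by (auto simp only: split_paired_all)
    with S.subset False show False by auto
  qed
  have unique: "s = s'" if "(c, k, s) \<in> S" "(c, k, s') \<in> S" for c k s s'
  proof (rule ccontr)
    assume "s \<noteq> s'"
    with that have ck: "(c, k, False) \<in> S" "(c, k, True) \<in> S" by (cases s; cases s'; simp)+
    have "inv\<^bsub>C2_D4\<^esub> (c, k, False) \<otimes>\<^bsub>C2_D4\<^esub> (c, k, True) \<in> S"
      using ck by blast
    moreover have "(c, k, True) = (c, k, False) \<otimes>\<^bsub>C2_D4\<^esub> (0, 0, True)"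
      using S.mem_carrier[OF ck(1)] unfolding mult_C2_D4 carrier_C2_D4 by auto
    moreover have "(0, 0, True) \<in> carrier C2_D4" by (simp only: carrier_C2_D4) simp
    ultimately show False
      using refl S.mem_carrier[OF ck(1)]
      by (metis G.inv_closed G.l_inv G.l_one G.m_assoc)
  qed
  obtain u v where u: "(0, 1, u) \<in> S" and v: "(1, 0, v) \<in> S" using proj by blast
  \<comment> \<open>If \<open>u\<close> is false, this is the square of \<open>(0, 1, u)\<close>. Otherwise that square is trivial, but multiplying
    \<open>(0, 2, True)\<close> by \<open>(0, 1, True)\<close> would give a second element over \<open>(0, 1)\<close>.\<close>
  have two: "(0, 2, False) \<in> S"
  proof (cases u)
    case False
    with mult[OF u u] show ?thesis by simp
  next
    case True
    obtain s where s: "(0, 2, s) \<in> S" using proj by blast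
    have "\<not> s"
    proof
      assume s
      with mult[OF s u] True have "(0, 1, False) \<in> S" by simp
      with unique[OF u] True show False by blast
    qed
    with s show ?thesis by simp
  qed
  have three: "(0, 3, u) \<in> S" using mult[OF two u] by simp
  have zero: "(0, 0, False) \<in> S" using S.one_closed by (simp only: one_C2_D4)
  have rot: "(0, k, u \<and> odd k) \<in> S" if "k \<in> {0, 1, 2, 3}" for k
    using that zero u two three by auto
  have mem: "(c, k, (u \<and> odd k) \<noteq> (v \<and> odd c)) \<in> S" if "c \<in> {0, 1}" "k \<in> {0, 1, 2, 3}" for c k
    using rot[OF that(2)] mult[OF rot[OF that(2)] v] that by (cases u) auto
  have "S = index_two_subgroup u v"
  proof (intro equalityI subsetI)
    fix t assume "t \<in> index_two_subgroup u v"
    then show "t \<in> S" using mem by (auto simp only: index_two_subgroup_def carrier_C2_D4)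
  next
    fix t assume t: "t \<in> S"
    obtain c k s where [simp]: "t = (c, k, s)" by (cases t)
    have ck: "(c, k, s) \<in> carrier C2_D4" using S.mem_carrier[OF t] by simp
    have "s = ((u \<and> odd k) \<noteq> (v \<and> odd c))"
      using t ck by (intro unique[OF _ mem]) (auto simp only: carrier_C2_D4 \<open>t = _\<close>)
    with ck show "t \<in> index_two_subgroup u v" by (simp add: index_two_subgroup_def)
  qed
  then show ?thesis by blast
qed simp

text \<open>The kernel has only one element over each pair \<open>(c, k)\<close>, so a subset that projects onto all pairs
  cannot omit any.\<close>
lemma subset_index_two_subgroup_eq:
  assumes sub: "S \<subseteq> index_two_subgroup u v"
    and proj: "\<And>c k. c \<in> {0, 1} \<Longrightarrow> k \<in> {0, 1, 2, 3} \<Longrightarrow> \<exists>s. (c, k, s) \<in> S"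
  shows "S = index_two_subgroup u v"
proof (intro equalityI subsetI)
  fix t assume t: "t \<in> index_two_subgroup u v"
  obtain c k s where [simp]: "t = (c, k, s)" by (cases t)
  obtain s' where s': "(c, k, s') \<in> S"
    using t proj by (auto simp only: index_two_subgroup_def carrier_C2_D4 \<open>t = _\<close>)
  with sub t have "s' = s" by (auto simp: index_two_subgroup_def)
  with s' show "t \<in> S" by simp
qed (use sub in auto)

text \<open>Without reflections, only the rotations and the inversion remain.\<close>
lemma index_two_subgroup_iso_C4_C2:
  "C2_D4\<lparr>carrier := index_two_subgroup False False\<rparr> \<cong> integer_mod_group 4 \<times>\<times> integer_mod_group 2"
proof -
  have "(\<lambda>(c, k, s). (k, c)) \<in> iso (C2_D4\<lparr>carrier := index_two_subgroup False False\<rparr>)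
      (integer_mod_group 4 \<times>\<times> integer_mod_group 2)"
    by (rule isoI, auto simp: hom_def index_two_subgroup_def dihedral_group_def
      carrier_integer_mod_group bij_betw_def inj_on_def image_def)
  then show ?thesis by (auto simp: is_iso_def)
qed

text \<open>Here the inversion \<open>c\<close> is a character of the dihedral part, so that the subgroup is the graph of a
  homomorphism on \<open>D\<^sub>4\<close>.\<close>
lemma index_two_subgroup_iso_D4:
  "C2_D4\<lparr>carrier := index_two_subgroup True True\<rparr> \<cong> dihedral_group 4"
proof -
  have "(\<lambda>(c, k, s). (k, s)) \<in> iso (C2_D4\<lparr>carrier := index_two_subgroup True True\<rparr>) (dihedral_group 4)"
  proof (rule isoI)
    show "bij_betw (\<lambda>(c, k, s). (k, s)) (carrier (C2_D4\<lparr>carrier := index_two_subgroup True True\<rparr>))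
       (carrier (dihedral_group 4))"
      by (rule bij_betwI[where g = "\<lambda>(k, s). (of_bool (odd k \<noteq> s), k, s)"])
        (auto simp: index_two_subgroup_def dihedral_group_def carrier_C2)
  qed (auto simp: hom_def index_two_subgroup_def dihedral_group_def)
  then show ?thesis by (auto simp: is_iso_def)
qed

text \<open>Even rotations together with the reflections \<open>(k, True)\<close>, \<open>k\<close> odd, form a Klein four-group in
  \<open>D\<^sub>4\<close>; the two binary digits of \<open>k\<close> are coordinates on it.\<close>
lemma index_two_subgroup_iso_C2_C2_C2:
  "C2_D4\<lparr>carrier := index_two_subgroup True False\<rparr> \<cong>
   integer_mod_group 2 \<times>\<times> integer_mod_group 2 \<times>\<times> integer_mod_group 2"
proof -
  have "(\<lambda>(c, k, s). (c, k div 2, k mod 2)) \<in> iso (C2_D4\<lparr>carrier := index_two_subgroup True False\<rparr>)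
     (integer_mod_group 2 \<times>\<times> integer_mod_group 2 \<times>\<times> integer_mod_group 2)"
  proof (rule isoI)
    have key: "((if odd k then k - k' else k + k') mod 4) div 2 = (k div 2 + k' div 2) mod 2 \<and>
        ((if odd k then k - k' else k + k') mod 4) mod 2 = (k mod 2 + k' mod 2) mod 2"
      if "k \<in> {0, 1, 2, 3}" "k' \<in> {0, 1, 2, 3}" for k k' :: int
      using that by (elim insertE emptyE; simp)
    show "bij_betw (\<lambda>(c, k, s). (c, k div 2, k mod 2))
        (carrier (C2_D4\<lparr>carrier := index_two_subgroup True False\<rparr>))
        (carrier (integer_mod_group 2 \<times>\<times> integer_mod_group 2 \<times>\<times> integer_mod_group 2))"
      by (rule bij_betwI[where g = "\<lambda>(c, x, y). (c, 2 * x + y, odd y)"])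
        (auto simp: index_two_subgroup_def dihedral_group_def carrier_integer_mod_group)
    show "(\<lambda>(c, k, s). (c, k div 2, k mod 2)) \<in> hom (C2_D4\<lparr>carrier := index_two_subgroup True False\<rparr>)
     (integer_mod_group 2 \<times>\<times> integer_mod_group 2 \<times>\<times> integer_mod_group 2)"
      by (rule homI) (auto simp: index_two_subgroup_def mult_D4 key carrier_integer_mod_group carrier_D4
          simp del: insert_iff split del: if_split)
  qed
  then show ?thesis by (auto simp: is_iso_def)
qed

text \<open>The effect of a triple on the index \<open>(n, m)\<close> of the root \<open>(\<i>\<^sup>m \<alpha>)\<close>, inverted if \<open>n = 1\<close>.\<close>
definition root_action :: "int \<times> int \<times> bool \<Rightarrow> int \<times> int \<Rightarrow> int \<times> int" where
  "root_action = (\<lambda>(c, k, s) (n, m). ((c + n) mod 2, (if s then k - m else k + m) mod 4))"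

lemma root_action_closed:
  "x \<in> {0, 1} \<times> {0, 1, 2, 3} \<Longrightarrow> root_action g x \<in> {0, 1} \<times> {0, 1, 2, 3}"
proof -
  have "z mod 2 \<in> {0, 1}" "z mod 4 \<in> {0, 1, 2, 3}" for z :: int
    unfolding insert_iff empty_iff by presburger+
  then show ?thesis by (auto simp: root_action_def split_beta)
qed

lemma root_action_one: "x \<in> {0, 1} \<times> {0, 1, 2, 3} \<Longrightarrow> root_action \<one>\<^bsub>C2_D4\<^esub> x = x"
  by (auto simp: one_C2_D4 root_action_def simp del: one_DirProd)

lemma root_action_mult: "root_action (g \<otimes>\<^bsub>C2_D4\<^esub> h) x = root_action g (root_action h x)"
  by (cases g; cases h; cases x)
    (auto simp: mult_C2_D4 root_action_def mod_simps algebra_simps simp del: mult_DirProd)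

lemma root_action_faithful:
  assumes gh: "g \<in> carrier C2_D4" "h \<in> carrier C2_D4"
    and eq: "\<And>x. x \<in> {0, 1} \<times> {0, 1, 2, 3} \<Longrightarrow> root_action g x = root_action h x"
  shows "g = h"
proof -
  obtain c k s c' k' s' where [simp]: "g = (c, k, s)" "h = (c', k', s')" by (cases g; cases h)
  have ck: "c = c'" "k = k'"
    using eq[of "(0, 0)"] gh unfolding \<open>g = _\<close> \<open>h = _\<close> carrier_C2_D4
    by (cases s; cases s'; auto simp: root_action_def)+
  have "s = s'"
    using eq[of "(0, 1)"] gh unfolding \<open>g = _\<close> \<open>h = _\<close> carrier_C2_D4
    by (cases s; cases s') (auto simp: root_action_def ck)
  with ck show ?thesis by simp
qed

section \<open>Automorphisms of splitting fields\<close>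

lemma in_galois_automorphisms_iff:
  "\<sigma> \<in> galois_automorphisms f \<longleftrightarrow>
    bij_betw \<sigma> (splitting_field f) (splitting_field f) \<and>
    (\<forall>x\<in>splitting_field f. \<forall>y\<in>splitting_field f. \<sigma> (x + y) = \<sigma> x + \<sigma> y \<and> \<sigma> (x * y) = \<sigma> x * \<sigma> y) \<and>
    (\<forall>q\<in>\<rat>. \<sigma> q = q)"
  by (auto simp: galois_automorphisms_def ring_iso_def ring_hom_def complex_field_def
      ring_of_type_algebra_def bij_betw_def)

lemma complex_field_simps:
  "x \<oplus>\<^bsub>complex_field\<^esub> y = x + y" "x \<otimes>\<^bsub>complex_field\<^esub> y = x * y"
  "\<one>\<^bsub>complex_field\<^esub> = 1" "\<zero>\<^bsub>complex_field\<^esub> = 0" "carrier complex_field = UNIV"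
  by (simp_all add: complex_field_def ring_of_type_algebra_def)

lemma a_inv_complex_field: "\<ominus>\<^bsub>complex_field\<^esub> x = - x"
proof -
  interpret field complex_field unfolding complex_field_def by (rule field_from_type_algebra)
  show ?thesis by (rule minus_equality) (simp_all add: complex_field_simps)
qed

lemma m_inv_complex_field: "x \<noteq> 0 \<Longrightarrow> inv\<^bsub>complex_field\<^esub> x = inverse x"
proof -
  assume "x \<noteq> 0"
  interpret field complex_field unfolding complex_field_def by (rule field_from_type_algebra)
  show ?thesis by (rule comm_inv_char) (use \<open>x \<noteq> 0\<close> in \<open>simp_all add: complex_field_simps\<close>)
qed

lemma splitting_field_closed:
  shows "x \<in> splitting_field f \<Longrightarrow> y \<in> splitting_field f \<Longrightarrow> x + y \<in> splitting_field f"
    and "x \<in> splitting_field f \<Longrightarrow> y \<in> splitting_field f \<Longrightarrow> x * y \<in> splitting_field f"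
    and "x \<in> splitting_field f \<Longrightarrow> inverse x \<in> splitting_field f"
    and "q \<in> \<rat> \<Longrightarrow> q \<in> splitting_field f"
    and "z \<in> complex_roots f \<Longrightarrow> z \<in> splitting_field f"
proof -
  show rat: "q \<in> splitting_field f" if "q \<in> \<rat>" for q
    unfolding splitting_field_def using that by (intro generate_field.incl) auto
  show "x + y \<in> splitting_field f" if "x \<in> splitting_field f" "y \<in> splitting_field f"
    using that generate_field.eng_add[of x complex_field _ y]
    by (simp add: splitting_field_def complex_field_simps)
  show "x * y \<in> splitting_field f" if "x \<in> splitting_field f" "y \<in> splitting_field f"
    using that generate_field.eng_mult[of x complex_field _ y]
    by (simp add: splitting_field_def complex_field_simps)
  show "inverse x \<in> splitting_field f" if "x \<in> splitting_field f"
  proof (cases "x = 0")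
    case False
    then show ?thesis using that generate_field.m_inv[of x complex_field]
      by (simp add: splitting_field_def complex_field_simps m_inv_complex_field)
  qed (simp add: rat)
  show "z \<in> splitting_field f" if "z \<in> complex_roots f"
    unfolding splitting_field_def using that by (intro generate_field.incl) auto
qed

lemma splitting_field_eval_rat:
  "z \<in> splitting_field f \<Longrightarrow> eval_rat p z \<in> splitting_field f"
  by (induction p) (auto intro!: splitting_field_closed(1,2) intro: splitting_field_closed(4))

lemma splitting_field_power_int: "z \<in> splitting_field f \<Longrightarrow> z powi n \<in> splitting_field f"
proof -
  have nat: "x ^ n \<in> splitting_field f" if "x \<in> splitting_field f" for x n
    by (induction n) (auto intro: splitting_field_closed(2,4) that)
  show "z powi n \<in> splitting_field f" if "z \<in> splitting_field f"
    unfolding power_int_def using nat that splitting_field_closed(3) by auto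
qed

lemma splitting_field_subset:
  assumes "\<rat> \<subseteq> A" "complex_roots f \<subseteq> A"
    and "\<And>x y. x \<in> A \<Longrightarrow> y \<in> A \<Longrightarrow> x + y \<in> A" "\<And>x y. x \<in> A \<Longrightarrow> y \<in> A \<Longrightarrow> x * y \<in> A"
    and inv: "\<And>x. x \<in> A \<Longrightarrow> x \<noteq> 0 \<Longrightarrow> inverse x \<in> A"
  shows "splitting_field f \<subseteq> A"
proof
  have neg: "- x \<in> A" if "x \<in> A" for x using assms(4)[of "-1" x] subsetD[OF assms(1), of "-1"] that by simp
  fix x assume "x \<in> splitting_field f"
  then show "x \<in> A"
    unfolding splitting_field_def
    by (induction rule: generate_field.induct)
      (use assms neg in \<open>auto simp: complex_field_simps a_inv_complex_field m_inv_complex_field\<close>)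
qed

lemma galois_automorphism_eval_rat:
  assumes "\<sigma> \<in> galois_automorphisms f" "z \<in> splitting_field f"
  shows "\<sigma> (eval_rat p z) = eval_rat p (\<sigma> z)"
proof (induction p)
  case 0
  then show ?case using assms(1) by (auto simp: in_galois_automorphisms_iff)
next
  case (pCons c p)
  then show ?case
    using assms by (simp add: in_galois_automorphisms_iff splitting_field_closed splitting_field_eval_rat)
qed

lemma galois_automorphism_comp:
  assumes "\<sigma> \<in> galois_automorphisms f" "\<tau> \<in> galois_automorphisms f"
  shows "\<sigma> \<circ> \<tau> \<in> galois_automorphisms f"
  using assms bij_betw_trans[of \<tau> "splitting_field f" "splitting_field f" \<sigma>]
  by (auto simp: in_galois_automorphisms_iff dest: bij_betwE)

lemma galois_automorphism_root:
  assumes "\<sigma> \<in> galois_automorphisms f" "z \<in> complex_roots f"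
  shows "\<sigma> z \<in> complex_roots f"
  using galois_automorphism_eval_rat[OF assms(1), of z f] assms splitting_field_closed(5)
  by (auto simp: complex_roots_eval_rat in_galois_automorphisms_iff)

lemma galois_automorphism_power_int:
  assumes \<sigma>: "\<sigma> \<in> galois_automorphisms f" and z: "z \<in> splitting_field f"
  shows "\<sigma> (z powi n) = \<sigma> z powi n"
proof -
  have nat: "\<sigma> (x ^ n) = \<sigma> x ^ n" if "x \<in> splitting_field f" for x n
    using galois_automorphism_eval_rat[OF \<sigma> that, of "Polynomial.monom 1 n"] by simp
  have "\<sigma> (inverse z) = inverse (\<sigma> z)"
  proof (cases "z = 0")
    case True
    then show ?thesis using \<sigma> by (auto simp: in_galois_automorphisms_iff)
  next
    case False
    have "\<sigma> (inverse z * z) = \<sigma> (inverse z) * \<sigma> z"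
      using \<sigma> z by (simp add: in_galois_automorphisms_iff splitting_field_closed)
    moreover have "\<sigma> 1 = 1" using \<sigma> by (simp add: in_galois_automorphisms_iff)
    ultimately show ?thesis using False by (metis inverse_unique left_inverse mult.commute)
  qed
  then show ?thesis
    using nat[OF z] nat[OF splitting_field_closed(3)[OF z]] by (simp add: power_int_def)
qed

section \<open>The roots of the octic\<close>

lemma power_int_imaginary_mod_4: "\<i> powi (m mod 4) = \<i> powi m"
proof -
  have "\<i> powi m = \<i> powi (4 * (m div 4) + m mod 4)" by simp
  also have "\<dots> = (\<i> powi 4) powi (m div 4) * \<i> powi (m mod 4)"
    by (subst power_int_add) (simp_all add: power_int_mult)
  also have "\<i> powi 4 = 1" by simp
  finally show ?thesis by simp
qed

lemma square_eq_minus_one: "(j::complex)\<^sup>2 = -1 \<longleftrightarrow> j = \<i> \<or> j = - \<i>"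
proof -
  have "j\<^sup>2 + 1 = (j - \<i>) * (j + \<i>)" by (simp add: algebra_simps power2_eq_square)
  then show ?thesis by (metis add_eq_0_iff add.inverse_inverse eq_iff_diff_eq_0 mult_eq_0_iff add.commute)
qed

lemma power4_eq_iff: "(z::complex) ^ 4 = w ^ 4 \<longleftrightarrow> (\<exists>m\<in>{0, 1, 2, 3}. z = \<i> powi m * w)"
proof -
  have cube: "\<i> ^ 3 = - \<i>" by (simp add: numeral_eq_Suc)
  have factors: "z ^ 4 - w ^ 4 = (z - w) * (z + w) * (z - \<i> * w) * (z + \<i> * w)"
    by (simp add: algebra_simps numeral_eq_Suc)
  have "z ^ 4 = w ^ 4 \<longleftrightarrow> z ^ 4 - w ^ 4 = 0" by simp
  also have "\<dots> \<longleftrightarrow> z = w \<or> z = \<i> * w \<or> z = - w \<or> z = - (\<i> * w)"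
    unfolding factors by (auto simp: eq_neg_iff_add_eq_0)
  also have "\<dots> \<longleftrightarrow> (\<exists>m\<in>{0, 1, 2, 3}. z = \<i> powi m * w)"
    by (simp add: cube)
  finally show ?thesis .
qed

lemma imaginary_powi_inj:
  "\<i> powi m = \<i> powi m' \<Longrightarrow> m \<in> {0, 1, 2, 3} \<Longrightarrow> m' \<in> {0, 1, 2, 3} \<Longrightarrow> m = m'"
  by (auto simp: complex_eq_iff numeral_eq_Suc)

locale irreducible_octic =
  fixes a :: rat and \<alpha> :: complex
  assumes irreducible: "Factorial_Ring.irreducible (octic a)"
    and root: "\<alpha> \<in> complex_roots (octic a)"
begin

abbreviation K :: "complex set" where "K \<equiv> splitting_field (octic a)"

lemma octic_eq_0: "\<alpha> ^ 8 + of_rat a * \<alpha> ^ 4 + 1 = 0"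
  using root by (simp add: complex_roots_eval_rat)

lemma eval_octic: "eval_rat (octic a) \<alpha> = 0"
  using octic_eq_0 by simp

lemma root_nonzero: "\<alpha> \<noteq> 0"
  using octic_eq_0 by auto

text \<open>Otherwise \<open>\<alpha>\<close> would be a root of a rational polynomial of degree 4.\<close>
lemma root_power4_irrational: "\<alpha> ^ 4 \<noteq> of_rat q"
proof
  assume "\<alpha> ^ 4 = of_rat q"
  moreover define p where "p = [:-q, 0, 0, 0, 1:]"
  ultimately have "eval_rat p \<alpha> = 0" by (simp add: of_rat_minus algebra_simps numeral_eq_Suc)
  then have "Polynomial.degree (octic a) \<le> Polynomial.degree p"
    by (rule irreducible_degree_le[OF irreducible eval_octic]) (simp add: p_def)
  then show False by (simp add: p_def)
qed

text \<open>If \<open>\<alpha>\<^sup>8 = 1\<close>, then \<open>a \<alpha>\<^sup>4 = - 2\<close>, and \<open>\<alpha>\<^sup>4\<close> would be rational.\<close>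
lemma root_power8_neq_1: "\<alpha> ^ 8 \<noteq> 1"
proof
  assume *: "\<alpha> ^ 8 = 1"
  with octic_eq_0 have **: "of_rat a * \<alpha> ^ 4 = - 2" by (simp add: eq_neg_iff_add_eq_0 add_ac)
  then have "a \<noteq> 0" by auto
  with ** have "\<alpha> ^ 4 = of_rat (- 2 / a)" by (simp add: of_rat_divide of_rat_minus field_simps)
  then show False using root_power4_irrational by blast
qed

lemma eval_root_inverse: "eval_rat p \<alpha> \<noteq> 0 \<Longrightarrow> \<exists>v. eval_rat v \<alpha> = inverse (eval_rat p \<alpha>)"
proof -
  assume "eval_rat p \<alpha> \<noteq> 0"
  then have "\<not> octic a dvd p" using eval_octic by (auto elim!: dvdE)
  from irreducible_eval_unit[OF irreducible eval_octic this] show ?thesis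
    by (metis inverse_unique mult.commute)
qed

lemma conjugate: "eval_rat p \<alpha> = 0 \<Longrightarrow> \<beta> \<in> complex_roots (octic a) \<Longrightarrow> eval_rat p \<beta> = 0"
  using irreducible_conjugate_root[OF irreducible eval_octic] by (auto simp: complex_roots_eval_rat)

text \<open>The exponent \<open>1 - 2 n\<close> turns \<open>n = 0, 1\<close> into the signs \<open>1, -1\<close>, so that inversion of roots becomes
  addition modulo 2 on \<open>n\<close>.\<close>
definition indexed_root :: "int \<times> int \<Rightarrow> complex" where
  "indexed_root = (\<lambda>(n, m). (\<i> powi m * \<alpha>) powi (1 - 2 * n))"

lemma coefficient_eq: "of_rat a = - (\<alpha> ^ 4) - inverse \<alpha> ^ 4"
proof -
  have "(of_rat a + \<alpha> ^ 4 + inverse \<alpha> ^ 4) * \<alpha> ^ 4 = \<alpha> ^ 8 + of_rat a * \<alpha> ^ 4 + 1"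
    using root_nonzero by (simp add: algebra_simps flip: power_add power_mult_distrib)
  then have "of_rat a + \<alpha> ^ 4 + inverse \<alpha> ^ 4 = 0" using octic_eq_0 root_nonzero by simp
  then show ?thesis by (simp add: eq_neg_iff_add_eq_0 algebra_simps)
qed

text \<open>As a quadratic polynomial in \<open>z\<^sup>4\<close>, the octic has the roots \<open>\<alpha>\<^sup>4\<close> and \<open>\<alpha>\<^sup>-\<^sup>4\<close>, whose product is 1.\<close>
lemma octic_roots_iff: "z \<in> complex_roots (octic a) \<longleftrightarrow> z ^ 4 = \<alpha> ^ 4 \<or> z ^ 4 = inverse \<alpha> ^ 4"
proof -
  have "(z ^ 4 - \<alpha> ^ 4) * (z ^ 4 - inverse \<alpha> ^ 4) = z ^ 8 + of_rat a * z ^ 4 + 1"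
    using root_nonzero
    by (simp add: coefficient_eq algebra_simps power_inverse flip: power_add power_mult_distrib)
  then show ?thesis by (auto simp: complex_roots_eval_rat)
qed

lemma indexed_root_power4:
  assumes "n \<in> {0, 1}" "m \<in> {0, 1, 2, 3}"
  shows "indexed_root (n, m) ^ 4 = (\<alpha> ^ 4) powi (1 - 2 * n)"
proof -
  have "(\<i> powi m * \<alpha>) ^ 4 = \<alpha> ^ 4" using assms(2) power4_eq_iff by blast
  then show ?thesis using assms(1)
    by (auto simp: indexed_root_def power_int_minus power_inverse simp del: inverse_mult_distrib)
qed

text \<open>The exponent \<open>n\<close> is recovered from the fourth power, because \<open>\<alpha>\<^sup>4 \<noteq> \<alpha>\<^sup>-\<^sup>4\<close>; the exponent \<open>m\<close> is
  then the number of a fourth root of unity.\<close>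
lemma indexed_root_bij: "bij_betw indexed_root ({0, 1} \<times> {0, 1, 2, 3}) (complex_roots (octic a))"
proof -
  have img: "indexed_root ` ({0, 1} \<times> {0, 1, 2, 3}) = complex_roots (octic a)"
  proof (intro equalityI subsetI)
    fix z assume "z \<in> indexed_root ` ({0, 1} \<times> {0, 1, 2, 3})"
    then obtain n m where z: "z = indexed_root (n, m)" "n \<in> {0, 1}" "m \<in> {0, 1, 2, 3}" by blast
    show "z \<in> complex_roots (octic a)"
      using indexed_root_power4[OF z(2,3)] z(2) by (auto simp: z(1) octic_roots_iff power_int_minus power_inverse)
  next
    fix z assume "z \<in> complex_roots (octic a)"
    then have "z ^ 4 = \<alpha> ^ 4 \<or> inverse z ^ 4 = \<alpha> ^ 4"
      unfolding octic_roots_iff by (metis inverse_inverse_eq power_inverse)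
    then obtain m where m: "m \<in> {0, 1, 2, 3}" and "z = \<i> powi m * \<alpha> \<or> inverse z = \<i> powi m * \<alpha>"
      unfolding power4_eq_iff by blast
    then have "z = indexed_root (0, m) \<or> z = indexed_root (1, m)"
      by (simp add: indexed_root_def power_int_minus del: inverse_mult_distrib) (metis inverse_inverse_eq)
    with m show "z \<in> indexed_root ` ({0, 1} \<times> {0, 1, 2, 3})" by blast
  qed
  have "inj_on indexed_root ({0, 1} \<times> {0, 1, 2, 3})"
  proof (rule inj_onI, clarify, rule conjI)
    fix n m n' m' :: int
    assume n: "n \<in> {0, 1}" "n' \<in> {0, 1}" and m: "m \<in> {0, 1, 2, 3}" "m' \<in> {0, 1, 2, 3}"
      and eq: "indexed_root (n, m) = indexed_root (n', m')"
    show nn: "n = n'"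
    proof (rule ccontr)
      assume "n \<noteq> n'"
      then have "\<alpha> ^ 4 = inverse (\<alpha> ^ 4)"
        using indexed_root_power4[OF n(1) m(1)] indexed_root_power4[OF n(2) m(2)] eq n by (auto simp: power_int_minus)
      then have "\<alpha> ^ 4 * \<alpha> ^ 4 = 1" using root_nonzero by (metis power_not_zero right_inverse)
      then show False using root_power8_neq_1 by (simp flip: power_add)
    qed
    have "\<i> powi m = \<i> powi m'"
      using eq n root_nonzero by (auto simp: indexed_root_def nn power_int_minus)
    then show "m = m'" using m by (rule imaginary_powi_inj)
  qed
  with img show ?thesis by (simp add: bij_betw_def)
qed

lemma card_octic_roots: "card (complex_roots (octic a)) = 8"
  using bij_betw_same_card[OF indexed_root_bij] by (simp add: card_cartesian_product)

section \<open>The splitting field as an extension by one root and the imaginary unit\<close>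

lemma irreducible_octic_conjugate: "\<beta> \<in> complex_roots (octic a) \<Longrightarrow> irreducible_octic a \<beta>"
  using irreducible by (rule irreducible_octic.intro)

lemma i_in_splitting_field: "\<i> \<in> K"
proof -
  have "indexed_root (0, 1) \<in> K" "\<alpha> \<in> K"
    using splitting_field_closed(5) bij_betwE[OF indexed_root_bij] root by auto
  then have "indexed_root (0, 1) * inverse \<alpha> \<in> K" by (intro splitting_field_closed(2,3))
  then show ?thesis using root_nonzero by (simp add: indexed_root_def mult.assoc)
qed

lemma root_in_splitting_field: "\<alpha> \<in> K"
  using splitting_field_closed(5) root by auto

text \<open>Rationalise the denominator with the norm \<open>p\<^sup>2 + q\<^sup>2\<close>, which lies in the field \<open>\<rat>[\<alpha>]\<close>. If the norm
  vanishes, then \<open>p + \<i> q\<close> is itself an element of \<open>\<rat>[\<alpha>]\<close>, namely \<open>2 p\<close>.\<close>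
lemma rational_adjoin_inverse:
  assumes "eval_rat p \<alpha> + \<i> * eval_rat q \<alpha> \<noteq> 0"
  shows "\<exists>p' q'. inverse (eval_rat p \<alpha> + \<i> * eval_rat q \<alpha>) = eval_rat p' \<alpha> + \<i> * eval_rat q' \<alpha>"
proof (cases "eval_rat (p\<^sup>2 + q\<^sup>2) \<alpha> = 0")
  case False
  then obtain v where v: "eval_rat v \<alpha> = inverse (eval_rat (p\<^sup>2 + q\<^sup>2) \<alpha>)"
    using eval_root_inverse by blast
  have norm: "eval_rat (p\<^sup>2 + q\<^sup>2) \<alpha> =
      (eval_rat p \<alpha> + \<i> * eval_rat q \<alpha>) * (eval_rat p \<alpha> - \<i> * eval_rat q \<alpha>)"
    by (simp add: algebra_simps power2_eq_square)
  have "inverse (eval_rat p \<alpha> + \<i> * eval_rat q \<alpha>) =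
      (eval_rat p \<alpha> - \<i> * eval_rat q \<alpha>) * inverse (eval_rat (p\<^sup>2 + q\<^sup>2) \<alpha>)"
    using False unfolding norm by simp
  also have "\<dots> = eval_rat (p * v) \<alpha> + \<i> * eval_rat (- (q * v)) \<alpha>"
    unfolding v[symmetric] by (simp add: algebra_simps)
  finally show ?thesis by blast
next
  case True
  then have "(eval_rat p \<alpha> + \<i> * eval_rat q \<alpha>) * (eval_rat p \<alpha> - \<i> * eval_rat q \<alpha>) = 0"
    by (simp add: algebra_simps power2_eq_square)
  with assms have "eval_rat p \<alpha> = \<i> * eval_rat q \<alpha>" by simp
  then have double: "eval_rat p \<alpha> + \<i> * eval_rat q \<alpha> = eval_rat (2 * p) \<alpha>"
    by (metis eval_rat_add mult_2)
  with assms obtain v where "eval_rat v \<alpha> = inverse (eval_rat (2 * p) \<alpha>)"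
    using eval_root_inverse by metis
  then have "inverse (eval_rat p \<alpha> + \<i> * eval_rat q \<alpha>) = eval_rat v \<alpha> + \<i> * eval_rat 0 \<alpha>"
    unfolding double by simp
  then show ?thesis by blast
qed

lemma splitting_field_eq: "K = {eval_rat p \<alpha> + \<i> * eval_rat q \<alpha> | p q. True}" (is "_ = ?E")
proof (intro equalityI subsetI)
  have intro: "eval_rat p \<alpha> + \<i> * eval_rat q \<alpha> \<in> ?E" for p q by blast
  have mult: "x * y \<in> ?E" if "x \<in> ?E" "y \<in> ?E" for x y
  proof -
    from that obtain p q p' q' where
      "x = eval_rat p \<alpha> + \<i> * eval_rat q \<alpha>" "y = eval_rat p' \<alpha> + \<i> * eval_rat q' \<alpha>" by blast
    then have "x * y = eval_rat (p * p' - q * q') \<alpha> + \<i> * eval_rat (p * q' + q * p') \<alpha>"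
      by (simp add: algebra_simps)
    then show ?thesis by blast
  qed
  have inv: "inverse x \<in> ?E" if "x \<in> ?E" "x \<noteq> 0" for x
    using that rational_adjoin_inverse by fastforce
  have i: "\<i> \<in> ?E" using intro[of 0 1] by simp
  have \<alpha>: "\<alpha> \<in> ?E" using intro[of "[:0, 1:]" 0] by simp
  have one: "1 \<in> ?E" using intro[of 1 0] by simp
  have pow: "\<i> powi m \<in> ?E" if "m \<in> {0, 1, 2, 3}" for m
  proof -
    have "\<i> ^ n \<in> ?E" for n by (induction n) (use one i mult in auto)
    from this[of "nat m"] that show ?thesis by (auto simp: power_int_def)
  qed
  have roots: "complex_roots (octic a) \<subseteq> ?E"
  proof
    fix z assume "z \<in> complex_roots (octic a)"
    then obtain n m where z: "z = indexed_root (n, m)" "n \<in> {0, 1}" "m \<in> {0, 1, 2, 3}"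
      using bij_betw_imp_surj_on[OF indexed_root_bij] by blast
    have "\<i> powi m * \<alpha> \<in> ?E" by (rule mult[OF pow[OF z(3)] \<alpha>])
    moreover have "\<i> powi m * \<alpha> \<noteq> 0" using root_nonzero by simp
    ultimately show "z \<in> ?E"
      using z(2) inv[of "\<i> powi m * \<alpha>"] by (elim insertE emptyE) (simp_all add: z(1) indexed_root_def power_int_minus
         del: inverse_mult_distrib)
  qed
  have rat: "\<rat> \<subseteq> ?E"
  proof
    fix x :: complex assume "x \<in> \<rat>"
    then obtain r where "x = of_rat r" by (rule Rats_cases)
    then show "x \<in> ?E" using intro[of "[:r:]" 0] by simp
  qed
  have add: "x + y \<in> ?E" if "x \<in> ?E" "y \<in> ?E" for x y
  proof -
    from that obtain p q p' q' where
      "x = eval_rat p \<alpha> + \<i> * eval_rat q \<alpha>" "y = eval_rat p' \<alpha> + \<i> * eval_rat q' \<alpha>" by blast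
    then have "x + y = eval_rat (p + p') \<alpha> + \<i> * eval_rat (q + q') \<alpha>"
      by (simp add: algebra_simps)
    then show ?thesis by blast
  qed
  fix x
  show "x \<in> ?E" if "x \<in> K"
    using splitting_field_subset[OF rat roots add mult inv] that by blast
  show "x \<in> K" if "x \<in> ?E"
    using that by (auto intro!: splitting_field_closed(1,2) splitting_field_eval_rat
      i_in_splitting_field root_in_splitting_field)
qed

section \<open>Existence of automorphisms and the fixed field\<close>

text \<open>Exactly the condition under which sending \<open>\<alpha>\<close> to \<open>\<beta>\<close> and \<open>\<i>\<close> to \<open>j\<close> gives a well-defined map on the
  splitting field.\<close>
definition specializes :: "complex \<Rightarrow> complex \<Rightarrow> bool" where
  "specializes \<beta> j \<longleftrightarrow> (\<forall>p q. eval_rat p \<alpha> + \<i> * eval_rat q \<alpha> = 0 \<longrightarrow> eval_rat p \<beta> + j * eval_rat q \<beta> = 0)"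

text \<open>If \<open>\<i> = h(\<alpha>)\<close>, then every relation between \<open>\<alpha>\<close> and \<open>\<i>\<close> is a polynomial relation for \<open>\<alpha>\<close> alone, and
  those hold for all roots of the irreducible polynomial. The image of \<open>\<i>\<close> has to be \<open>h(\<beta>)\<close>.\<close>
lemma specializes_eval:
  assumes h: "eval_rat h \<alpha> = \<i>" and \<beta>: "\<beta> \<in> complex_roots (octic a)"
  shows "(eval_rat h \<beta>)\<^sup>2 = -1" "specializes \<beta> (eval_rat h \<beta>)"
proof -
  have "eval_rat (h\<^sup>2 + 1) \<alpha> = 0" using h by simp
  from conjugate[OF this \<beta>] show "(eval_rat h \<beta>)\<^sup>2 = -1" by (simp add: eq_neg_iff_add_eq_0)
  show "specializes \<beta> (eval_rat h \<beta>)" unfolding specializes_def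
  proof (intro allI impI)
    fix p q assume "eval_rat p \<alpha> + \<i> * eval_rat q \<alpha> = 0"
    then have "eval_rat (p + h * q) \<alpha> = 0" using h by simp
    from conjugate[OF this \<beta>] show "eval_rat p \<beta> + eval_rat h \<beta> * eval_rat q \<beta> = 0" by simp
  qed
qed

text \<open>If \<open>\<i> \<notin> \<rat>(\<alpha>)\<close>, then \<open>1\<close> and \<open>\<i>\<close> are linearly independent over \<open>\<rat>(\<alpha>)\<close>, and the image of \<open>\<i>\<close> may be
  chosen independently of that of \<open>\<alpha>\<close>.\<close>
lemma specializes_if_no_i:
  assumes no: "\<And>h. eval_rat h \<alpha> \<noteq> \<i>" and \<beta>: "\<beta> \<in> complex_roots (octic a)"
  shows "specializes \<beta> j"
  unfolding specializes_def
proof (intro allI impI)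
  fix p q assume pq: "eval_rat p \<alpha> + \<i> * eval_rat q \<alpha> = 0"
  have "eval_rat q \<alpha> = 0"
  proof (rule ccontr)
    assume q: "eval_rat q \<alpha> \<noteq> 0"
    then obtain v where "eval_rat v \<alpha> = inverse (eval_rat q \<alpha>)" using eval_root_inverse by blast
    moreover have "eval_rat p \<alpha> = - \<i> * eval_rat q \<alpha>" using pq by (simp add: eq_neg_iff_add_eq_0)
    ultimately have "eval_rat (- (p * v)) \<alpha> = \<i>" using q by simp
    then show False using no by blast
  qed
  with pq show "eval_rat p \<beta> + j * eval_rat q \<beta> = 0"
    using conjugate[OF _ \<beta>] by simp
qed

text \<open>The map is onto because \<open>\<beta>\<close> is as good a generator of the splitting field as \<open>\<alpha>\<close>.\<close>
lemma specialization_automorphism: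
  assumes \<beta>: "\<beta> \<in> complex_roots (octic a)" and j: "j\<^sup>2 = -1" and sp: "specializes \<beta> j"
  shows "\<exists>\<sigma>\<in>galois_automorphisms (octic a). \<sigma> \<alpha> = \<beta> \<and> \<sigma> \<i> = j"
proof -
  interpret \<beta>: irreducible_octic a \<beta> by (rule irreducible_octic_conjugate[OF \<beta>])
  have "\<exists>\<sigma>. \<forall>p q. \<sigma> (eval_rat p \<alpha> + \<i> * eval_rat q \<alpha>) = eval_rat p \<beta> + j * eval_rat q \<beta>"
  proof -
    have "\<exists>w. \<forall>p q. z = eval_rat p \<alpha> + \<i> * eval_rat q \<alpha> \<longrightarrow> w = eval_rat p \<beta> + j * eval_rat q \<beta>" for z
    proof (cases "z \<in> K")
      case True
      then obtain p q where z: "z = eval_rat p \<alpha> + \<i> * eval_rat q \<alpha>" by (auto simp: splitting_field_eq)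
      have "eval_rat p \<beta> + j * eval_rat q \<beta> = eval_rat p' \<beta> + j * eval_rat q' \<beta>"
        if "z = eval_rat p' \<alpha> + \<i> * eval_rat q' \<alpha>" for p' q'
      proof -
        have "eval_rat (p - p') \<alpha> + \<i> * eval_rat (q - q') \<alpha> = 0"
          using that z by (simp add: algebra_simps)
        then have "eval_rat (p - p') \<beta> + j * eval_rat (q - q') \<beta> = 0"
          using sp unfolding specializes_def by blast
        then show ?thesis by (simp add: algebra_simps)
      qed
      then show ?thesis by blast
    qed (auto simp: splitting_field_eq)
    then show ?thesis by metis
  qed
  then obtain \<sigma> where \<sigma>: "\<And>p q. \<sigma> (eval_rat p \<alpha> + \<i> * eval_rat q \<alpha>) = eval_rat p \<beta> + j * eval_rat q \<beta>"
    by blast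
  have rat: "\<sigma> (of_rat r) = of_rat r" for r
    using \<sigma>[of "[:r:]" 0] by simp
  have hom: "\<sigma> (x + y) = \<sigma> x + \<sigma> y \<and> \<sigma> (x * y) = \<sigma> x * \<sigma> y" if "x \<in> K" "y \<in> K" for x y
  proof -
    from that obtain p q p' q' where
      xy: "x = eval_rat p \<alpha> + \<i> * eval_rat q \<alpha>" "y = eval_rat p' \<alpha> + \<i> * eval_rat q' \<alpha>"
      by (auto simp: splitting_field_eq)
    have "x + y = eval_rat (p + p') \<alpha> + \<i> * eval_rat (q + q') \<alpha>"
      "x * y = eval_rat (p * p' - q * q') \<alpha> + \<i> * eval_rat (p * q' + q * p') \<alpha>"
      by (simp_all add: xy algebra_simps)
    then have "\<sigma> (x + y) = eval_rat (p + p') \<beta> + j * eval_rat (q + q') \<beta>"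
      "\<sigma> (x * y) = eval_rat (p * p' - q * q') \<beta> + j * eval_rat (p * q' + q * p') \<beta>"
      using \<sigma> by metis+
    note sums = this
    have images: "\<sigma> x = eval_rat p \<beta> + j * eval_rat q \<beta>" "\<sigma> y = eval_rat p' \<beta> + j * eval_rat q' \<beta>"
      by (simp_all add: xy \<sigma>)
    have jj: "j * (j * z) = - z" for z using j by (simp add: power2_eq_square flip: mult.assoc)
    show ?thesis unfolding sums images by (simp add: algebra_simps jj)
  qed
  \<comment> \<open>A nonzero element has an inverse in the field, so its image cannot be 0.\<close>
  have inj: "inj_on \<sigma> K"
  proof (rule inj_onI, rule ccontr)
    fix x y assume xy: "x \<in> K" "y \<in> K" "\<sigma> x = \<sigma> y" "x \<noteq> y"
    have m: "-1 * y \<in> K" using splitting_field_closed(2)[OF splitting_field_closed(4) xy(2), of "-1"] by simp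
    define d where "d = x + -1 * y"
    have d: "d \<in> K" unfolding d_def by (rule splitting_field_closed(1)[OF xy(1) m])
    have "\<sigma> (-1 * y) = - \<sigma> y" using hom[of "-1" y] rat[of "-1"] xy splitting_field_closed(4)[of "-1" "octic a"]
      by (simp add: of_rat_minus)
    then have "\<sigma> d = 0" using hom[OF xy(1) m] xy(3) by (simp add: d_def)
    moreover have "\<sigma> (d * inverse d) = \<sigma> d * \<sigma> (inverse d)"
      using hom[OF d splitting_field_closed(3)[OF d]] by simp
    moreover have "d * inverse d = 1" using xy(4) by (simp add: d_def)
    ultimately show False using rat[of 1] by simp
  qed
  have img: "\<sigma> ` K = K"
  proof -
    have "\<sigma> ` K = {eval_rat p \<beta> + j * eval_rat q \<beta> | p q. True}"
      unfolding splitting_field_eq by (auto simp: \<sigma> image_iff) (metis \<sigma>)+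
    also have "\<dots> = {eval_rat p \<beta> + \<i> * eval_rat q \<beta> | p q. True}"
    proof -
      obtain r :: rat where "j = of_rat r * \<i>" "\<i> = of_rat r * j"
      proof (cases "j = \<i>")
        case True
        then show ?thesis by (intro that[of 1]) simp_all
      next
        case False
        then have "j = - \<i>" using j square_eq_minus_one by blast
        then show ?thesis by (intro that[of "-1"]) (simp_all add: of_rat_minus)
      qed
      then have "j * eval_rat q \<beta> = \<i> * eval_rat (Polynomial.smult r q) \<beta>"
        "\<i> * eval_rat q \<beta> = j * eval_rat (Polynomial.smult r q) \<beta>" for q
        by (simp_all add: mult_ac)
      then show ?thesis by (intro equalityI subsetI) (clarify, metis)+
    qed
    also have "\<dots> = K" by (rule \<beta>.splitting_field_eq[symmetric])
    finally show ?thesis .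
  qed
  have "\<sigma> \<in> galois_automorphisms (octic a)"
    using hom inj img rat by (auto simp: in_galois_automorphisms_iff bij_betw_def elim!: Rats_cases)
  moreover have "\<sigma> \<alpha> = \<beta>" "\<sigma> \<i> = j" using \<sigma>[of "[:0, 1:]" 0] \<sigma>[of 0 1] by simp_all
  ultimately show ?thesis by blast
qed

lemma galois_automorphism_eval:
  assumes \<sigma>: "\<sigma> \<in> galois_automorphisms (octic a)"
  shows "\<sigma> (eval_rat p \<alpha> + \<i> * eval_rat q \<alpha>) = eval_rat p (\<sigma> \<alpha>) + \<sigma> \<i> * eval_rat q (\<sigma> \<alpha>)"
  using \<sigma> galois_automorphism_eval_rat[OF \<sigma> root_in_splitting_field]
  by (simp add: in_galois_automorphisms_iff splitting_field_closed(1,2) splitting_field_eval_rat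
      i_in_splitting_field root_in_splitting_field)

lemma galois_automorphism_i: "\<sigma> \<in> galois_automorphisms (octic a) \<Longrightarrow> \<sigma> \<i> = \<i> \<or> \<sigma> \<i> = - \<i>"
proof -
  assume \<sigma>: "\<sigma> \<in> galois_automorphisms (octic a)"
  have "eval_rat [:1, 0, 1:] (\<sigma> \<i>) = \<sigma> 0"
    using galois_automorphism_eval_rat[OF \<sigma> i_in_splitting_field, of "[:1, 0, 1:]"] by simp
  also have "\<sigma> 0 = 0" using \<sigma> by (simp add: in_galois_automorphisms_iff)
  finally have "(\<sigma> \<i>)\<^sup>2 = -1" by (simp add: power2_eq_square eq_neg_iff_add_eq_0 add.commute)
  then show ?thesis by (simp add: square_eq_minus_one)
qed

lemma galois_transitive:
  assumes \<beta>: "\<beta> \<in> complex_roots (octic a)"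
  shows "\<exists>\<sigma>\<in>galois_automorphisms (octic a). \<sigma> \<alpha> = \<beta>"
proof (cases "\<exists>h. eval_rat h \<alpha> = \<i>")
  case True
  then show ?thesis using specializes_eval[OF _ \<beta>] specialization_automorphism[OF \<beta>] by blast
next
  case False
  then show ?thesis using specializes_if_no_i[OF _ \<beta>, of \<i>] specialization_automorphism[OF \<beta>, of \<i>] by auto
qed

text \<open>An element fixed by all automorphisms already lies in \<open>\<rat>(\<alpha>)\<close>: either \<open>\<rat>(\<alpha>)\<close> contains \<open>\<i>\<close>, or the
  automorphism that fixes \<open>\<alpha>\<close> and negates \<open>\<i>\<close> shows it. As a polynomial in \<open>\<alpha>\<close> it takes the same value at
  all the conjugates of \<open>\<alpha>\<close>.\<close>
lemma fixed_imp_rational: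
  assumes x: "x \<in> K" and fixed: "\<And>\<sigma>. \<sigma> \<in> galois_automorphisms (octic a) \<Longrightarrow> \<sigma> x = x"
  shows "x \<in> \<rat>"
proof -
  have "\<exists>p. x = eval_rat p \<alpha>"
  proof (cases "\<exists>h. eval_rat h \<alpha> = \<i>")
    case True
    then obtain h where h: "eval_rat h \<alpha> = \<i>" by blast
    obtain p q where "x = eval_rat p \<alpha> + \<i> * eval_rat q \<alpha>" using x by (auto simp: splitting_field_eq)
    then have "x = eval_rat (p + h * q) \<alpha>" using h by simp
    then show ?thesis by blast
  next
    case False
    obtain p q where pq: "x = eval_rat p \<alpha> + \<i> * eval_rat q \<alpha>" using x by (auto simp: splitting_field_eq)
    obtain \<sigma> where \<sigma>: "\<sigma> \<in> galois_automorphisms (octic a)" "\<sigma> \<alpha> = \<alpha>" "\<sigma> \<i> = - \<i>"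
      using specialization_automorphism[OF root, of "- \<i>"] specializes_if_no_i[OF _ root, of "- \<i>"] False by auto
    have "x = eval_rat p \<alpha> - \<i> * eval_rat q \<alpha>"
      using fixed[OF \<sigma>(1)] galois_automorphism_eval[OF \<sigma>(1), of p q] \<sigma> pq by simp
    with pq show ?thesis by auto
  qed
  then obtain p where p: "x = eval_rat p \<alpha>" ..
  show ?thesis
  proof (rule constant_on_roots_imp_rational[where f = "octic a" and g = p])
    fix \<beta> assume "\<beta> \<in> complex_roots (octic a)"
    then obtain \<sigma> where \<sigma>: "\<sigma> \<in> galois_automorphisms (octic a)" "\<sigma> \<alpha> = \<beta>" using galois_transitive by blast
    then show "eval_rat p \<beta> = x"
      using galois_automorphism_eval_rat[OF \<sigma>(1) root_in_splitting_field, of p] fixed[OF \<sigma>(1)] p by simp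
  qed (simp_all add: card_octic_roots)
qed

section \<open>The Galois group inside the group of order sixteen\<close>

text \<open>The sign of the exponent of \<open>\<i>\<close> is forced by the requirement that \<open>\<sigma>\<close> permutes the roots by
  \<open>root_action\<close>: since the inversion by \<open>c\<close> is applied to \<open>\<i>\<^sup>m \<alpha>\<close> as a whole, it contributes to the image
  of \<open>\<i>\<close>.\<close>
definition realizes :: "(complex \<Rightarrow> complex) \<Rightarrow> int \<times> int \<times> bool \<Rightarrow> bool" where
  "realizes \<sigma> = (\<lambda>(c, k, s). \<sigma> \<alpha> = indexed_root (c, k) \<and> \<sigma> \<i> = \<i> powi ((1 - 2 * c) * (if s then -1 else 1)))"

definition galois_triples :: "(int \<times> int \<times> bool) set" where
  "galois_triples = {t \<in> carrier C2_D4. \<exists>\<sigma>\<in>galois_automorphisms (octic a). realizes \<sigma> t}"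

lemma power_int_sign: "c \<in> {0, 1} \<Longrightarrow> (z::complex) powi ((1 - 2 * c) * e) = (z powi e) powi (1 - 2 * c)"
  by (subst mult.commute) (simp add: power_int_mult)

lemma realizes_root_action:
  assumes \<sigma>: "\<sigma> \<in> galois_automorphisms (octic a)" and t: "t \<in> carrier C2_D4" and rt: "realizes \<sigma> t"
    and x: "x \<in> {0, 1} \<times> {0, 1, 2, 3}"
  shows "\<sigma> (indexed_root x) = indexed_root (root_action t x)"
proof -
  obtain c k s n m where [simp]: "t = (c, k, s)" "x = (n, m)" by (cases t; cases x)
  have c: "c \<in> {0, 1}" using t by (simp only: carrier_C2_D4 \<open>t = _\<close>)
  define e :: int where "e = (if s then -1 else 1)"
  have r: "\<sigma> \<alpha> = (\<i> powi k * \<alpha>) powi (1 - 2 * c)" "\<sigma> \<i> = (\<i> powi e) powi (1 - 2 * c)"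
    using rt power_int_sign[OF c] by (simp_all add: realizes_def indexed_root_def e_def)
  have "\<sigma> (\<i> powi m * \<alpha>) = \<sigma> \<i> powi m * \<sigma> \<alpha>"
    using \<sigma> galois_automorphism_power_int[OF \<sigma> i_in_splitting_field, of m]
      splitting_field_power_int[OF i_in_splitting_field] root_in_splitting_field
    by (simp add: in_galois_automorphisms_iff)
  also have "\<sigma> \<i> powi m = (\<i> powi (e * m)) powi (1 - 2 * c)"
    by (simp only: r power_int_mult[symmetric] mult_ac)
  also have "\<dots> * \<sigma> \<alpha> = (\<i> powi (k + e * m) * \<alpha>) powi (1 - 2 * c)"
    by (simp add: r power_int_add flip: power_int_mult_distrib) (simp add: mult_ac)
  finally have "\<sigma> (\<i> powi m * \<alpha>) = (\<i> powi (k + e * m) * \<alpha>) powi (1 - 2 * c)" .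
  moreover have "\<i> powi m * \<alpha> \<in> K"
    by (intro splitting_field_closed(2) splitting_field_power_int i_in_splitting_field root_in_splitting_field)
  ultimately have "\<sigma> (indexed_root x) = (\<i> powi (k + e * m) * \<alpha>) powi ((1 - 2 * c) * (1 - 2 * n))"
    by (simp add: indexed_root_def galois_automorphism_power_int[OF \<sigma>] power_int_mult)
  also have "(1 - 2 * c) * (1 - 2 * n) = 1 - 2 * ((c + n) mod 2)" using c x by auto
  also have "\<i> powi (k + e * m) = \<i> powi ((if s then k - m else k + m) mod 4)"
    by (simp add: power_int_imaginary_mod_4 e_def)
  finally show ?thesis by (simp add: indexed_root_def root_action_def)
qed

lemma realizes_mult:
  assumes \<sigma>: "\<sigma> \<in> galois_automorphisms (octic a)" and t: "t \<in> carrier C2_D4" "realizes \<sigma> t"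
    and \<tau>: "\<tau> \<in> galois_automorphisms (octic a)" and t': "t' \<in> carrier C2_D4" "realizes \<tau> t'"
  shows "realizes (\<sigma> \<circ> \<tau>) (t \<otimes>\<^bsub>C2_D4\<^esub> t')"
proof -
  obtain c k s c' k' s' where tt: "t = (c, k, s)" "t' = (c', k', s')" by (cases t; cases t')
  have c: "c \<in> {0, 1}" "c' \<in> {0, 1}" "k' \<in> {0, 1, 2, 3}"
    using t(1) t'(1) unfolding tt carrier_C2_D4 by auto
  have "\<tau> \<alpha> = indexed_root (c', k')" using t'(2) by (simp add: realizes_def tt)
  moreover have "(c', k') \<in> {0, 1} \<times> {0, 1, 2, 3}" using c by blast
  ultimately have "\<sigma> (\<tau> \<alpha>) = indexed_root (root_action t (c', k'))"
    using realizes_root_action[OF \<sigma> t] by simp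
  then have root: "(\<sigma> \<circ> \<tau>) \<alpha> = indexed_root ((c + c') mod 2, (if s then k - k' else k + k') mod 4)"
    by (simp add: root_action_def tt)
  have "\<sigma> (\<tau> \<i>) = \<sigma> \<i> powi ((1 - 2 * c') * (if s' then -1 else 1))"
    using t' galois_automorphism_power_int[OF \<sigma> i_in_splitting_field] by (simp add: realizes_def tt)
  also have "\<dots> = \<i> powi (((1 - 2 * c) * (if s then -1 else 1)) * ((1 - 2 * c') * (if s' then -1 else 1)))"
    using t by (simp only: realizes_def tt prod.case power_int_mult)
  also have "((1 - 2 * c) * (if s then -1 else 1)) * ((1 - 2 * c') * (if s' then -1 else 1)) =
      (1 - 2 * ((c + c') mod 2)) * (if s \<noteq> s' then -1 else 1)"
    using c by auto
  finally show ?thesis using root by (simp only: tt mult_C2_D4 realizes_def prod.case o_apply simp_thms)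
qed

lemma realizes_exists:
  assumes \<sigma>: "\<sigma> \<in> galois_automorphisms (octic a)"
  shows "\<exists>t\<in>carrier C2_D4. realizes \<sigma> t"
proof -
  have "\<sigma> \<alpha> \<in> complex_roots (octic a)" by (rule galois_automorphism_root[OF \<sigma> root])
  then obtain c k where ck: "\<sigma> \<alpha> = indexed_root (c, k)" "c \<in> {0, 1}" "k \<in> {0, 1, 2, 3}"
    using bij_betw_imp_surj_on[OF indexed_root_bij] by blast
  have "realizes \<sigma> (c, k, odd c \<noteq> (\<sigma> \<i> = - \<i>))"
    using galois_automorphism_i[OF \<sigma>] ck by (auto simp: realizes_def power_int_minus)
  moreover have "(c, k, odd c \<noteq> (\<sigma> \<i> = - \<i>)) \<in> carrier C2_D4" using ck(2,3) by (simp only: carrier_C2_D4)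
  ultimately show ?thesis by blast
qed

lemma realizes_i:
  assumes "realizes \<sigma> (c, k, s)" "(c, k, s) \<in> carrier C2_D4"
  shows "\<sigma> \<i> = (if odd c \<noteq> s then - \<i> else \<i>)"
  using assms unfolding carrier_C2_D4 by (auto simp: realizes_def power_int_minus)

lemma subgroup_galois_triples: "subgroup galois_triples C2_D4"
proof (rule group.finite_closed_imp_subgroup[OF group_C2_D4 finite_C2_D4])
  show "galois_triples \<noteq> {}"
    using galois_transitive[OF root] realizes_exists unfolding galois_triples_def by blast
  fix t t' assume "t \<in> galois_triples" "t' \<in> galois_triples"
  then show "t \<otimes>\<^bsub>C2_D4\<^esub> t' \<in> galois_triples"
    using realizes_mult galois_automorphism_comp monoid.m_closed[OF group.is_monoid[OF group_C2_D4]]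
    unfolding galois_triples_def by blast
qed (auto simp: galois_triples_def)

text \<open>Since the base point has index \<open>(0, 0)\<close>, the pair \<open>(c, k)\<close> is the index of its image, and the claim is
  the transitivity of the Galois group.\<close>
lemma galois_triples_project:
  assumes "c \<in> {0, 1}" "k \<in> {0, 1, 2, 3}"
  shows "\<exists>s. (c, k, s) \<in> galois_triples"
proof -
  have ck: "(c, k) \<in> {0, 1} \<times> {0, 1, 2, 3}" using assms by blast
  then have "indexed_root (c, k) \<in> complex_roots (octic a)" using bij_betwE[OF indexed_root_bij] by blast
  then obtain \<sigma> where \<sigma>: "\<sigma> \<in> galois_automorphisms (octic a)" "\<sigma> \<alpha> = indexed_root (c, k)"
    using galois_transitive by blast
  obtain c' k' s where t: "(c', k', s) \<in> carrier C2_D4" "realizes \<sigma> (c', k', s)"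
    using realizes_exists[OF \<sigma>(1)] by (metis prod_cases3)
  then have "indexed_root (c', k') = indexed_root (c, k)" using \<sigma>(2) by (simp add: realizes_def)
  moreover have "(c', k') \<in> {0, 1} \<times> {0, 1, 2, 3}" using t(1) by (simp only: carrier_C2_D4 mem_Times_iff fst_conv snd_conv)
  ultimately have "(c', k') = (c, k)" using ck bij_betw_imp_inj_on[OF indexed_root_bij] by (metis inj_onD)
  with t \<sigma> show ?thesis by (auto simp: galois_triples_def)
qed

lemma galois_perm_group_transitive_iso:
  assumes "root_labelling (octic a) r"
  shows "galois_perm_group (octic a) r \<in> transitive_perm_groups_iso 8 (C2_D4\<lparr>carrier := galois_triples\<rparr>)"
proof -
  define I where "I = {1..8::nat}"
  have r: "bij_betw r I (complex_roots (octic a))"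
    using assms by (simp add: root_labelling_def I_def)
  define b where "b = the_inv_into ({0, 1} \<times> {0, 1, 2, 3}) indexed_root \<circ> r"
  have b: "bij_betw b I ({0, 1} \<times> {0, 1, 2, 3})"
    unfolding b_def by (rule bij_betw_trans[OF r bij_betw_the_inv_into[OF indexed_root_bij]])
  have nth_b: "indexed_root (b i) = r i" if "i \<in> I" for i
    unfolding b_def o_apply
    by (rule f_the_inv_into_f_bij_betw[OF indexed_root_bij]) (use r that in \<open>auto dest: bij_betwE\<close>)
  have b_mem: "b i \<in> {0, 1} \<times> {0, 1, 2, 3}" if "i \<in> I" for i using bij_betwE[OF b] that by blast
  have step: "\<sigma> (r i) = r (p i) \<longleftrightarrow> b (p i) = root_action t (b i)"
    if "\<sigma> \<in> galois_automorphisms (octic a)" "t \<in> carrier C2_D4" "realizes \<sigma> t" "i \<in> I" "p permutes I"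
    for \<sigma> t i p
  proof -
    have pi: "p i \<in> I" using that(4,5) by (simp add: permutes_in_image)
    have "\<sigma> (r i) = indexed_root (root_action t (b i))"
      using realizes_root_action[OF that(1-3) b_mem[OF that(4)]] nth_b[OF that(4)] by simp
    moreover have "r (p i) = indexed_root (b (p i))" using nth_b[OF pi] by simp
    ultimately show ?thesis
      using inj_on_eq_iff[OF bij_betw_imp_inj_on[OF indexed_root_bij] b_mem[OF pi]
          root_action_closed[OF b_mem[OF that(4)], of t]] by metis
  qed
  have eq: "galois_perm_group (octic a) r =
      {p \<in> carrier (sym_group 8). \<exists>t\<in>galois_triples. \<forall>i\<in>I. b (p i) = root_action t (b i)}"
    unfolding galois_perm_group_def degree_octic I_def[symmetric]
  proof (intro Collect_cong conj_cong refl)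
    fix p assume "p \<in> carrier (sym_group 8)"
    then have p: "p permutes I" by (simp add: sym_group_carrier I_def)
    show "(\<exists>\<sigma>\<in>galois_automorphisms (octic a). \<forall>i\<in>I. \<sigma> (r i) = r (p i)) \<longleftrightarrow>
        (\<exists>t\<in>galois_triples. \<forall>i\<in>I. b (p i) = root_action t (b i))"
      using step[OF _ _ _ _ p] realizes_exists unfolding galois_triples_def by blast
  qed
  show ?thesis
  proof (rule perm_group_of_faithful_action[OF group_C2_D4 subgroup_galois_triples,
        where act = root_action and \<Omega> = "{0, 1} \<times> {0, 1, 2, 3}" and b = b and ?x0.0 = "(0, 0)"])
    show "\<exists>g\<in>galois_triples. root_action g (0, 0) = x" if "x \<in> {0, 1} \<times> {0, 1, 2, 3}" for x
      using that galois_triples_project[of "fst x" "snd x"] by (force simp: root_action_def)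
    show "bij_betw b {1..8} ({0, 1} \<times> {0, 1, 2, 3})" using b by (simp add: I_def)
    show "galois_perm_group (octic a) r =
      {p \<in> carrier (sym_group 8). \<exists>t\<in>galois_triples. \<forall>i\<in>{1..8}. b (p i) = root_action t (b i)}"
      using eq by (simp add: I_def)
  qed (rule root_action_closed root_action_one root_action_mult root_action_faithful | blast)+
qed

lemma galois_group_is_if_iso:
  assumes "C2_D4\<lparr>carrier := galois_triples\<rparr> \<cong> G"
  shows "galois_group_is (octic a) (transitive_perm_groups_iso 8 G)"
proof -
  have "finite (complex_roots (octic a))" using card_octic_roots by (metis card.infinite zero_neq_numeral)
  from ex_bij_betw_nat_finite_1[OF this] have "\<exists>r. root_labelling (octic a) r"
    by (simp add: root_labelling_def card_octic_roots)
  then show ?thesis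
    using galois_perm_group_transitive_iso transitive_perm_groups_iso_cong[OF _ assms]
    by (auto simp: galois_group_is_def)
qed

section \<open>Index-two subgroups and rational squares\<close>

text \<open>The hypothesis on \<open>D\<close> says that automorphisms multiply \<open>\<i> D\<close> by the character whose kernel is
  \<open>index_two_subgroup u v\<close>. So the inclusion of the Galois group in the kernel means that \<open>\<i> D\<close> is fixed,
  that is rational, which is a condition on its square \<open>- \<delta>\<close>.\<close>
lemma rat_square_iff_galois_triples_subset:
  assumes D: "D \<in> K" "D \<noteq> 0" "D\<^sup>2 = of_rat \<delta>"
    and \<sigma>D: "\<And>\<sigma> c k s. \<sigma> \<in> galois_automorphisms (octic a) \<Longrightarrow> c \<in> {0, 1} \<Longrightarrow> k \<in> {0, 1, 2, 3} \<Longrightarrow>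
      \<sigma> \<alpha> = indexed_root (c, k) \<Longrightarrow> \<sigma> D = (if odd c \<noteq> ((u \<and> odd k) \<noteq> (v \<and> odd c)) then - D else D)"
  shows "- \<delta> \<in> rat_squares \<longleftrightarrow> galois_triples \<subseteq> index_two_subgroup u v"
proof -
  have iD: "\<sigma> (\<i> * D) = \<i> * D \<longleftrightarrow> (c, k, s) \<in> index_two_subgroup u v"
    if "\<sigma> \<in> galois_automorphisms (octic a)" "realizes \<sigma> (c, k, s)" "(c, k, s) \<in> carrier C2_D4" for \<sigma> c k s
  proof -
    have "c \<in> {0, 1}" "k \<in> {0, 1, 2, 3}" using that(3) unfolding carrier_C2_D4 by auto
    moreover have "\<sigma> \<alpha> = indexed_root (c, k)" using that(2) by (simp add: realizes_def)
    ultimately have 1: "\<sigma> D = (if odd c \<noteq> ((u \<and> odd k) \<noteq> (v \<and> odd c)) then - D else D)"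
      using \<sigma>D that(1) by blast
    have 2: "\<sigma> (\<i> * D) = \<sigma> \<i> * \<sigma> D"
      using that(1) i_in_splitting_field D(1) by (simp add: in_galois_automorphisms_iff)
    show ?thesis using D(2) that(3)
      unfolding 2 1 realizes_i[OF that(2,3)] index_two_subgroup_def mem_Collect_eq prod.case by auto
  qed
  have sq: "(\<i> * D)\<^sup>2 = of_rat (- \<delta>)" using D(3) by (simp add: power_mult_distrib of_rat_minus)
  show ?thesis
  proof
    assume "- \<delta> \<in> rat_squares"
    then obtain q where "- \<delta> = q\<^sup>2" by (auto simp: rat_squares_def)
    with sq have "(\<i> * D)\<^sup>2 = (of_rat q)\<^sup>2" by (simp add: of_rat_power)
    then have "\<i> * D = of_rat q \<or> \<i> * D = of_rat (- q)" by (simp add: power2_eq_iff of_rat_minus)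
    then have rat: "\<i> * D \<in> \<rat>" by (metis Rats_of_rat)
    show "galois_triples \<subseteq> index_two_subgroup u v"
    proof
      fix t assume t: "t \<in> galois_triples"
      obtain c k s where cks: "t = (c, k, s)" by (cases t)
      obtain \<sigma> where \<sigma>: "\<sigma> \<in> galois_automorphisms (octic a)" "realizes \<sigma> t" "t \<in> carrier C2_D4"
        using t by (auto simp: galois_triples_def)
      have "\<sigma> (\<i> * D) = \<i> * D" using \<sigma>(1) rat by (simp add: in_galois_automorphisms_iff)
      with iD \<sigma> show "t \<in> index_two_subgroup u v" unfolding cks by blast
    qed
  next
    assume sub: "galois_triples \<subseteq> index_two_subgroup u v"
    have "\<i> * D \<in> \<rat>"
    proof (rule fixed_imp_rational)
      show "\<i> * D \<in> K" by (rule splitting_field_closed(2)[OF i_in_splitting_field D(1)])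
      fix \<sigma> assume \<sigma>: "\<sigma> \<in> galois_automorphisms (octic a)"
      obtain c k s where t: "(c, k, s) \<in> carrier C2_D4" "realizes \<sigma> (c, k, s)"
        using realizes_exists[OF \<sigma>] by (metis prod_cases3)
      with \<sigma> have "(c, k, s) \<in> galois_triples" by (auto simp: galois_triples_def)
      with sub iD[OF \<sigma> t(2,1)] show "\<sigma> (\<i> * D) = \<i> * D" by blast
    qed
    then obtain q where "\<i> * D = of_rat q" by (rule Rats_cases)
    with sq have "of_rat (q\<^sup>2) = (of_rat (- \<delta>) :: complex)" by (simp add: of_rat_power)
    then have "- \<delta> = q\<^sup>2" by (simp only: of_rat_eq_iff)
    then show "- \<delta> \<in> rat_squares" by (auto simp: rat_squares_def)
  qed
qed

lemma galois_automorphism_laurent: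
  assumes \<sigma>: "\<sigma> \<in> galois_automorphisms (octic a)"
  shows "\<sigma> (\<alpha> ^ n + of_rat r * inverse (\<alpha> ^ n)) = \<sigma> \<alpha> ^ n + of_rat r * inverse (\<sigma> \<alpha> ^ n)"
proof -
  have "\<sigma> (\<alpha> ^ n) = \<sigma> \<alpha> ^ n" "\<sigma> (inverse (\<alpha> ^ n)) = inverse (\<sigma> \<alpha> ^ n)"
    using galois_automorphism_power_int[OF \<sigma> root_in_splitting_field, of "int n"]
      galois_automorphism_power_int[OF \<sigma> root_in_splitting_field, of "- int n"]
    by (simp_all add: power_int_minus)
  moreover have "\<alpha> ^ n \<in> K" "inverse (\<alpha> ^ n) \<in> K" "of_rat r \<in> K"
    using splitting_field_power_int[OF root_in_splitting_field, of "int n"]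
    by (auto intro: splitting_field_closed(3,4))
  ultimately show ?thesis
    using \<sigma> by (simp add: in_galois_automorphisms_iff splitting_field_closed(2))
qed

lemma laurent_in_splitting_field: "\<alpha> ^ n + of_rat r * inverse (\<alpha> ^ n) \<in> K"
  using splitting_field_power_int[OF root_in_splitting_field, of "int n"]
  by (auto intro!: splitting_field_closed(1,2,3) intro: splitting_field_closed(4))

lemma indexed_root_square:
  "c \<in> {0, 1} \<Longrightarrow> k \<in> {0, 1, 2, 3} \<Longrightarrow>
    indexed_root (c, k) ^ 2 = (if odd k then -1 else 1) * (\<alpha>\<^sup>2) powi (1 - 2 * c)"
  by (auto simp: indexed_root_def power_int_minus power_mult_distrib power_inverse simp flip: power_mult)

lemma laurent_square:
  assumes "r = 1 \<or> r = -1"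
  shows "(\<alpha> ^ n + of_rat r * inverse (\<alpha> ^ n))\<^sup>2 = \<alpha> ^ (2 * n) + inverse (\<alpha> ^ (2 * n)) + of_rat (2 * r)"
proof -
  have "\<alpha> ^ (2 * n) = \<alpha> ^ n * \<alpha> ^ n" by (simp add: mult_2 power_add)
  then show ?thesis
    using assms root_nonzero by (auto simp: power2_eq_square algebra_simps of_rat_minus)
qed

lemma laurent_nonzero:
  assumes "\<alpha> ^ (2 * n) \<noteq> - of_rat r"
  shows "\<alpha> ^ n + of_rat r * inverse (\<alpha> ^ n) \<noteq> 0"
proof
  assume "\<alpha> ^ n + of_rat r * inverse (\<alpha> ^ n) = 0"
  then have "(\<alpha> ^ n + of_rat r * inverse (\<alpha> ^ n)) * \<alpha> ^ n = 0" by simp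
  then have "\<alpha> ^ n * \<alpha> ^ n + of_rat r = 0" using root_nonzero by (simp add: algebra_simps)
  with assms show False by (simp add: mult_2 power_add eq_neg_iff_add_eq_0)
qed

text \<open>The case \<open>D = \<alpha>\<^sup>2 + r \<alpha>\<^sup>-\<^sup>2\<close>. Here \<open>D\<^sup>2 = \<alpha>\<^sup>4 + \<alpha>\<^sup>-\<^sup>4 + 2 r = 2 r - a\<close>.\<close>
lemma rat_square_iff_of_square_laurent:
  assumes r: "r = 1 \<or> r = -1"
  shows "a - 2 * r \<in> rat_squares \<longleftrightarrow> galois_triples \<subseteq> index_two_subgroup True (r = 1)"
proof -
  let ?D = "\<alpha> ^ 2 + of_rat r * inverse (\<alpha> ^ 2)"
  have "- (2 * r - a) \<in> rat_squares \<longleftrightarrow> galois_triples \<subseteq> index_two_subgroup True (r = 1)"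
  proof (rule rat_square_iff_galois_triples_subset)
    show "?D \<in> K" by (rule laurent_in_splitting_field)
    show "?D \<noteq> 0"
      using root_power4_irrational[of "- r"] by (intro laurent_nonzero) (simp add: of_rat_minus)
    show "?D\<^sup>2 = of_rat (2 * r - a)"
      using laurent_square[OF r, of 2] by (simp add: of_rat_diff coefficient_eq power_inverse)
    fix \<sigma> c k s assume "\<sigma> \<in> galois_automorphisms (octic a)" "c \<in> {0, 1::int}" "k \<in> {0, 1, 2, 3::int}"
      "\<sigma> \<alpha> = indexed_root (c, k)"
    then have "\<sigma> ?D = (if odd k then -1 else 1) * ((\<alpha>\<^sup>2) powi (1 - 2 * c) + of_rat r * inverse ((\<alpha>\<^sup>2) powi (1 - 2 * c)))"
      by (simp add: galois_automorphism_laurent indexed_root_square)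
    then show "\<sigma> ?D = (if odd c \<noteq> ((True \<and> odd k) \<noteq> ((r = 1) \<and> odd c)) then - ?D else ?D)"
      using r \<open>c \<in> {0, 1}\<close> by (auto simp: power_int_minus of_rat_minus)
  qed
  then show ?thesis by simp
qed

text \<open>The case \<open>D = \<alpha>\<^sup>4 - \<alpha>\<^sup>-\<^sup>4\<close>. Here \<open>D\<^sup>2 = (\<alpha>\<^sup>4 + \<alpha>\<^sup>-\<^sup>4)\<^sup>2 - 4 = a\<^sup>2 - 4\<close>.\<close>
lemma rat_square_iff_of_fourth_laurent:
  "4 - a\<^sup>2 \<in> rat_squares \<longleftrightarrow> galois_triples \<subseteq> index_two_subgroup False False"
proof -
  let ?D = "\<alpha> ^ 4 + of_rat (-1) * inverse (\<alpha> ^ 4)"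
  have "- (a\<^sup>2 - 4) \<in> rat_squares \<longleftrightarrow> galois_triples \<subseteq> index_two_subgroup False False"
  proof (rule rat_square_iff_galois_triples_subset)
    show "?D \<in> K" by (rule laurent_in_splitting_field)
    show "?D \<noteq> 0"
      using root_power8_neq_1 by (intro laurent_nonzero) (simp add: of_rat_minus)
    have "?D\<^sup>2 = (\<alpha> ^ 4 + inverse (\<alpha> ^ 4))\<^sup>2 - 4"
      using root_nonzero by (simp add: power2_eq_square algebra_simps of_rat_minus)
    also have "\<alpha> ^ 4 + inverse (\<alpha> ^ 4) = - of_rat a" by (simp add: coefficient_eq power_inverse)
    finally show "?D\<^sup>2 = of_rat (a\<^sup>2 - 4)" by (simp add: of_rat_diff of_rat_power)
    fix \<sigma> c k s assume "\<sigma> \<in> galois_automorphisms (octic a)" "c \<in> {0, 1::int}" "k \<in> {0, 1, 2, 3::int}"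
      "\<sigma> \<alpha> = indexed_root (c, k)"
    then have "\<sigma> ?D = (\<alpha> ^ 4) powi (1 - 2 * c) + of_rat (-1) * inverse ((\<alpha> ^ 4) powi (1 - 2 * c))"
      by (simp only: galois_automorphism_laurent indexed_root_power4)
    then show "\<sigma> ?D = (if odd c \<noteq> ((False \<and> odd k) \<noteq> (False \<and> odd c)) then - ?D else ?D)"
      using \<open>c \<in> {0, 1}\<close> by (auto simp: power_int_minus of_rat_minus)
  qed
  then show ?thesis by simp
qed

text \<open>The case \<open>D = 1\<close>: this kernel consists of the triples that fix \<open>\<i>\<close>, and \<open>\<i>\<close> is not rational.\<close>
lemma galois_triples_not_fixing_i: "\<not> galois_triples \<subseteq> index_two_subgroup False True"
proof -
  have "- 1 \<in> rat_squares \<longleftrightarrow> galois_triples \<subseteq> index_two_subgroup False True"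
  proof (rule rat_square_iff_galois_triples_subset[where D = 1])
    show "1 \<in> K" by (rule splitting_field_closed(4)) simp
  qed (auto simp: in_galois_automorphisms_iff)
  moreover have "q\<^sup>2 \<noteq> - 1" for q :: rat using zero_le_power2[of q] by linarith
  ultimately show ?thesis by (auto simp: rat_squares_def eq_commute)
qed

lemma galois_triples_eq: "galois_triples \<subseteq> index_two_subgroup u v \<Longrightarrow> galois_triples = index_two_subgroup u v"
  using subset_index_two_subgroup_eq galois_triples_project by blast

lemma galois_triples_full:
  assumes "a + 2 \<notin> rat_squares" "a - 2 \<notin> rat_squares" "4 - a\<^sup>2 \<notin> rat_squares"
  shows "galois_triples = carrier C2_D4"
proof (rule ccontr)
  assume "galois_triples \<noteq> carrier C2_D4"
  then obtain u v where uv: "galois_triples = index_two_subgroup u v"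
    using index_two_subgroup_cases[OF subgroup_galois_triples galois_triples_project] by blast
  then show False
    using assms rat_square_iff_of_square_laurent[of "-1"] rat_square_iff_of_square_laurent[of 1]
      rat_square_iff_of_fourth_laurent galois_triples_not_fixing_i
    by (cases u; cases v) simp_all
qed

lemma galois_group_cases:
  "(a + 2 \<in> rat_squares \<longrightarrow> galois_group_is (octic a) T8_3) \<and>
   (a - 2 \<in> rat_squares \<longrightarrow> galois_group_is (octic a) T8_4) \<and>
   (4 - a\<^sup>2 \<in> rat_squares \<longrightarrow> galois_group_is (octic a) T8_2) \<and>
   (a + 2 \<notin> rat_squares \<and> a - 2 \<notin> rat_squares \<and> 4 - a\<^sup>2 \<notin> rat_squares \<longrightarrow>
      galois_group_is (octic a) T8_9)"
proof (intro conjI impI)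
  assume "a + 2 \<in> rat_squares"
  then have "galois_triples = index_two_subgroup True False"
    using rat_square_iff_of_square_laurent[of "-1"] by (intro galois_triples_eq) simp
  then show "galois_group_is (octic a) T8_3"
    using galois_group_is_if_iso index_two_subgroup_iso_C2_C2_C2 by (simp add: T8_3_def)
next
  assume "a - 2 \<in> rat_squares"
  then have "galois_triples = index_two_subgroup True True"
    using rat_square_iff_of_square_laurent[of 1] by (intro galois_triples_eq) simp
  then show "galois_group_is (octic a) T8_4"
    using galois_group_is_if_iso index_two_subgroup_iso_D4 by (simp add: T8_4_def)
next
  assume "4 - a\<^sup>2 \<in> rat_squares"
  then have "galois_triples = index_two_subgroup False False"
    using rat_square_iff_of_fourth_laurent by (intro galois_triples_eq) simp
  then show "galois_group_is (octic a) T8_2"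
    using galois_group_is_if_iso index_two_subgroup_iso_C4_C2 by (simp add: T8_2_def)
next
  assume "a + 2 \<notin> rat_squares \<and> a - 2 \<notin> rat_squares \<and> 4 - a\<^sup>2 \<notin> rat_squares"
  then have "galois_triples = carrier C2_D4" using galois_triples_full by blast
  then have "C2_D4\<lparr>carrier := galois_triples\<rparr> = C2_D4" by simp
  then show "galois_group_is (octic a) T8_9"
    unfolding T8_9_def by (intro galois_group_is_if_iso) (simp only: iso_refl)
qed

end

theorem corollary3p9:
  fixes a :: rat
  assumes "Factorial_Ring.irreducible (octic a)"
  shows
    "(a + 2 \<in> rat_squares \<longrightarrow> galois_group_is (octic a) T8_3) \<and>
     (a + 2 \<notin> rat_squares \<and> a - 2 \<in> rat_squares \<longrightarrow> galois_group_is (octic a) T8_4) \<and>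
     (a + 2 \<notin> rat_squares \<and> a - 2 \<notin> rat_squares \<and> 4 - a\<^sup>2 \<in> rat_squares \<longrightarrow>
        galois_group_is (octic a) T8_2) \<and>
     (a + 2 \<notin> rat_squares \<and> a - 2 \<notin> rat_squares \<and> 4 - a\<^sup>2 \<notin> rat_squares \<longrightarrow>
        galois_group_is (octic a) T8_9)"
proof -
  obtain \<alpha> where "\<alpha> \<in> complex_roots (octic a)" using complex_root_exists[of "octic a"] by auto
  with assms interpret irreducible_octic a \<alpha> by (rule irreducible_octic.intro)
  show ?thesis using galois_group_cases by blast
qed

end
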